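(* Let $n\geq 2$. For any convex $n$-gon $P\subset\mathbb{R}^2$, one has $$L(P)\leq 2\left(1+(n-1)\sin\left(\frac{\pi}{2(n-1)}\right)\right)\cdot\delta(P),$$ where $L(P)$ is the perimeter of $P$, and equality holds if and only if $P$ is isometric to the $n$-gon $U_n$ (constructed with some radius $r>0$) defined in the context.
   Context: The plane $\mathbb{R}^2$ carries the standard Euclidean metric $d$. A convex polygon is a convex closed polygonal chain (the boundary curve, not including the interior); it is called an $n$-gon if it has exactly $n$ vertices. For $n=2$, an $n$-gon is a (nondegenerate) line segment, and its perimeter is defined as twice the length of the segment. For a compact set $\Gamma\subset\mathbb{R}^2$, the relative Chebyshev radius of $\Gamma$ is $$\delta(\Gamma)=\min_{p\in\Gamma}\max_{q\in\Gamma} d(p,q).$$ Definition of $U_n$, $n\geq 2$: let $P_n$ be a regular $2(n-1)$-gon inscribed in a circle of radius $r>0$ (for $n=2$, $P_2$ is a line segment of length $2r$, a diameter of the circle). Let $A,B\in P_n$ be opposite vertices, so $d(A,B)=2r$, and let $H$ be one of the two closed half-planes determined by the straight line $AB$. Then $U_n$ is the union of the line segment $[A,B]$ with the polygonal line $P_n\cap H$. It is an $n$-gon inscribed in the boundary of a half-disk of radius $r$; for $n=2$, $U_2$ is a line segment of length $2r$. *)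

theory Defs
  imports "HOL-Analysis.Analysis"
begin

text \<open>A closed polygonal chain is given by the list of its vertices in cyclic order; indices are
  taken modulo the length of the list.\<close>

definition closed_chain :: "(real^2) list \<Rightarrow> (real^2) set" where
  "closed_chain vs = (\<Union>i<length vs. closed_segment (vs ! i) (vs ! (Suc i mod length vs)))"

text \<open>The number of vertices is \<open>length vs\<close>: the listed points are distinct and each of them is
  a genuine corner (an extreme point), so no angle equals pi. For \<open>length vs = 2\<close> the predicate
  describes the nondegenerate segments, since a segment in the plane is its own frontier
  (\<open>convex_polygon_2\<close> below).\<close>

definition convex_polygon :: "(real^2) list \<Rightarrow> bool" where
  "convex_polygon vs \<longleftrightarrow>
     2 \<le> length vs \<and> distinct vs \<and>
     (\<forall>v\<in>set vs. v extreme_point_of (convex hull (set vs))) \<and>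
     closed_chain vs = frontier (convex hull (set vs))"

text \<open>For two vertices the cyclic sum runs over the segment back and forth, which gives the
  convention that the perimeter of a segment is twice its length (\<open>perimeter_2\<close> below).\<close>

definition perimeter :: "(real^2) list \<Rightarrow> real" where
  "perimeter vs = (\<Sum>i<length vs. dist (vs ! i) (vs ! (Suc i mod length vs)))"

text \<open>On nonempty compact sets the infimum and the supremum are attained, so they are the minimum
  and the maximum.\<close>

definition rel_chebyshev_radius :: "(real^2) set \<Rightarrow> real" where
  "rel_chebyshev_radius \<Gamma> = (INF p\<in>\<Gamma>. SUP q\<in>\<Gamma>. dist p q)"

definition regular_vertex :: "nat \<Rightarrow> real \<Rightarrow> nat \<Rightarrow> real^2" where
  "regular_vertex m r k = vector [r * cos (2 * pi * real k / real m), r * sin (2 * pi * real k / real m)]"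

text \<open>The regular \<open>m\<close>-gon inscribed in the circle of radius \<open>r\<close> about the origin; for \<open>m = 2\<close> it is
  a diameter.\<close>

definition regular_polygon :: "nat \<Rightarrow> real \<Rightarrow> (real^2) set" where
  "regular_polygon m r = closed_chain (map (regular_vertex m r) [0..<m])"

text \<open>The opposite vertices are those with indices \<open>0\<close> and \<open>n - 1\<close>, i.e. the points \<open>(r, 0)\<close> and
  \<open>(-r, 0)\<close>, and the half-plane is the closed upper one. Any other choice of the centre, the
  inscribed polygon, the pair of opposite vertices or the half-plane gives an isometric figure.\<close>

definition U :: "nat \<Rightarrow> real \<Rightarrow> (real^2) set" where
  "U n r =
     (let m = 2 * (n - 1) in
        closed_segment (regular_vertex m r 0) (regular_vertex m r (n - 1))
        \<union> (regular_polygon m r \<inter> {x. 0 \<le> x $ 2}))"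

definition isometric_sets :: "(real^2) set \<Rightarrow> (real^2) set \<Rightarrow> bool" where
  "isometric_sets S T \<longleftrightarrow>
     (\<exists>f :: real^2 \<Rightarrow> real^2. (\<forall>x y. dist (f x) (f y) = dist x y) \<and> f ` S = T)"

lemma closed_chain_2: "closed_chain [a, b] = closed_segment a b"
  by (auto simp: closed_chain_def lessThan_Suc closed_segment_commute)

lemma perimeter_2: "perimeter [a, b] = 2 * dist a b"
  by (simp add: perimeter_def lessThan_Suc dist_commute)

lemma convex_polygon_2: "convex_polygon [a, b] \<longleftrightarrow> a \<noteq> b"
proof -
  have "aff_dim (closed_segment a b) \<le> 1"
    by (simp add: segment_convex_hull aff_dim_convex_hull aff_dim_2)
  then have "interior (closed_segment a b) = {}"
    by (intro low_dim_interior) auto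
  then have "frontier (closed_segment a b) = closed_segment a b"
    by (simp add: frontier_def)
  then show ?thesis
    by (auto simp: convex_polygon_def closed_chain_2 extreme_point_of_segment
        simp flip: segment_convex_hull)
qed

end

theory Submission
  imports Defs
begin

text \<open>
  Let \<open>p\<close> be a point of \<open>P\<close> from which no point of \<open>P\<close> is farther away than \<open>\<delta>(P)\<close>, and take it as
  the origin. Then \<open>P\<close> lies in the disk of radius \<open>\<delta>(P)\<close>, and because \<open>p\<close> is on the boundary of a
  convex region, \<open>P\<close> even lies in a half-disk: the angles under which the edges missing \<open>p\<close> are seen
  from \<open>p\<close> add up to at most \<open>\<pi>\<close>.

  Now push every vertex other than \<open>p\<close> radially out to the circle of radius \<open>\<delta>(P)\<close>. This does not
  shorten the perimeter (\<open>radial_push_lengthens\<close>): if \<open>t\<^sub>k\<close> is the unit direction of the edge from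
  \<open>v\<^sub>k\<close> to \<open>v\<^sub>k\<^sub>+\<^sub>1\<close>, then summation by parts turns the perimeter \<open>\<Sum> (v\<^sub>k\<^sub>+\<^sub>1 - v\<^sub>k) \<bullet> t\<^sub>k\<close> into
  \<open>\<Sum> v\<^sub>k\<^sub>+\<^sub>1 \<bullet> (t\<^sub>k - t\<^sub>k\<^sub>+\<^sub>1)\<close>. The vector \<open>t\<^sub>k - t\<^sub>k\<^sub>+\<^sub>1\<close> is an outer normal at \<open>v\<^sub>k\<^sub>+\<^sub>1\<close>, so each term is
  nonnegative, the origin being in the region (\<open>inner_turn_pos\<close>), and grows under the push. The
  \<open>t\<^sub>k\<close> need not be the edge directions of the new polygon, but by the Cauchy-Schwarz inequality
  that can only make the new perimeter larger than the sum.

  If \<open>p\<close> is in the interior of an edge, the pushed polygon consists of a diameter and of \<open>n - 1\<close>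
  chords under angles with sum \<open>\<pi>\<close>. If \<open>p\<close> is a vertex, it consists of two radii and of \<open>n - 2\<close>
  chords, which may be counted as \<open>n - 1\<close> chords one of which has angle zero. In both cases the bound
  is Jensen's inequality for the sine (\<open>sum_sin_le\<close>). Equality forces all \<open>n - 1\<close> angles to be equal,
  hence \<open>p\<close> not to be a vertex, and forbids any proper push, so that the vertices are those of the
  inscribed half of a regular polygon (\<open>convex_polygon_about_origin_perimeter\<close>).

  Conversely, \<open>\<delta>(U\<^sub>n) = r\<close>, since every point has distance at least \<open>r\<close> from one of two points that
  are \<open>2 r\<close> apart. The hypothesis that \<open>P\<close> is isometric to \<open>U\<^sub>n\<close> speaks of point sets, while the
  perimeter is computed from the list of vertices; the link is that the edges are exactly the
  segments that join two extreme points inside the boundary (\<open>frontier_segment_is_edge\<close>).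
  A segment, the case \<open>n = 2\<close>, is isometric to \<open>U\<^sub>2\<close> and has perimeter four times \<open>\<delta>\<close>.
\<close>

section \<open>Pushing the vertices of a convex polygon outwards\<close>

text \<open>
  The cross product of plane vectors, positive if and only if \<open>b\<close> points to the left of \<open>a\<close>.
\<close>
definition wedge :: "complex \<Rightarrow> complex \<Rightarrow> real" where
  "wedge a b = Re a * Im b - Im a * Re b"

text \<open>
  By Cramer's rule \<open>x\<close> is a nonnegative combination of \<open>f\<close> and \<open>- e\<close>, and both of these have positive
  inner product with \<open>sgn f - sgn e\<close> because the two directions differ. In the application \<open>e\<close> and
  \<open>f\<close> are consecutive edges of a counterclockwise polygon and \<open>x\<close> points from their common vertex to
  the origin.
\<close>
lemma inner_turn_pos:
  assumes "wedge e f > 0" "wedge e x \<ge> 0" "wedge f x \<ge> 0" "x \<noteq> 0"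
  shows "0 < x \<bullet> (sgn f - sgn e)"
proof -
  have e0: "norm e > 0" and f0: "norm f > 0"
    using assms(1) by (auto simp: wedge_def)
  have lagrange: "(norm e * norm f)\<^sup>2 = (e \<bullet> f)\<^sup>2 + (wedge e f)\<^sup>2"
    unfolding power_mult_distrib cmod_power2 wedge_def inner_complex_def
    by (simp add: power2_eq_square algebra_simps)
  have "(e \<bullet> f)\<^sup>2 < (norm e * norm f)\<^sup>2"
    unfolding lagrange using assms(1) by simp
  then have lt: "e \<bullet> f < norm e * norm f"
    by (meson power2_less_imp_less mult_nonneg_nonneg norm_ge_zero)
  have f_pos: "f \<bullet> (sgn f - sgn e) > 0"
  proof -
    have "f \<bullet> (sgn f - sgn e) = (norm e * norm f - e \<bullet> f) / norm e"
      using e0 f0 by (simp add: sgn_div_norm inner_diff_right field_simps inner_commute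
          power2_norm_eq_inner[symmetric] power2_eq_square)
    then show ?thesis using lt e0 by simp
  qed
  have e_neg: "e \<bullet> (sgn f - sgn e) < 0"
  proof -
    have "e \<bullet> (sgn f - sgn e) = - (norm e * norm f - e \<bullet> f) / norm f"
      using e0 f0 by (simp add: sgn_div_norm inner_diff_right field_simps inner_commute
          power2_norm_eq_inner[symmetric] power2_eq_square)
    then show ?thesis using lt f0 by (simp add: divide_neg_pos)
  qed
  have x: "wedge e f *\<^sub>R x = wedge e x *\<^sub>R f - wedge f x *\<^sub>R e"
    by (simp add: complex_eq_iff wedge_def algebra_simps)
  have "wedge e x \<noteq> 0 \<or> wedge f x \<noteq> 0"
    using x assms(1,4) by auto
  then have "0 < wedge e x * (f \<bullet> (sgn f - sgn e)) + wedge f x * (- (e \<bullet> (sgn f - sgn e)))"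
    using assms(2,3) f_pos e_neg
    by (metis add_nonneg_pos add_pos_nonneg less_eq_real_def mult_nonneg_nonneg mult_pos_pos neg_0_less_iff_less)
  also have "\<dots> = wedge e f * (x \<bullet> (sgn f - sgn e))"
    using arg_cong[OF x, of "\<lambda>y. y \<bullet> (sgn f - sgn e)"] by (simp add: inner_diff_left)
  finally show ?thesis using assms(1) zero_less_mult_pos by blast
qed

lemma sum_periodic_shift:
  fixes h :: "nat \<Rightarrow> 'a::cancel_comm_monoid_add"
  assumes "\<And>k. h (k + n) = h k"
  shows "(\<Sum>k<n. h (s + k)) = (\<Sum>k<n. h k)"
proof (induction s)
  case (Suc s)
  have "(\<Sum>k<n. h (s + k)) + h (s + n) = h s + (\<Sum>k<n. h (Suc s + k))"
    using sum.lessThan_Suc_shift[of "\<lambda>k. h (s + k)" n] by simp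
  then show ?case using Suc assms[of s] by (simp add: add.commute)
qed simp

text \<open>
  Here \<open>turn\<close> says that the polygon turns left at every vertex and \<open>orig\<close> that the origin is not to
  the right of any edge. A vertex at the origin is not moved, since \<open>sgn 0 = 0\<close>. In the equality
  statement the vertices are numbered from \<open>1\<close> to \<open>n\<close>, as summation by parts produces them.
\<close>
lemma radial_push_lengthens:
  fixes g :: "nat \<Rightarrow> complex"
  assumes per: "\<And>k. g (k + n) = g k"
    and turn: "\<And>k. wedge (g (Suc k) - g k) (g (Suc (Suc k)) - g (Suc k)) > 0"
    and orig: "\<And>k. wedge (g k) (g (Suc k)) \<ge> 0"
    and r: "\<And>k. norm (g k) \<le> r"
  defines "w \<equiv> \<lambda>k. r *\<^sub>R sgn (g k)"
  shows "(\<Sum>k<n. norm (g (Suc k) - g k)) \<le> (\<Sum>k<n. norm (w (Suc k) - w k))"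
    and "(\<Sum>k<n. norm (g (Suc k) - g k)) = (\<Sum>k<n. norm (w (Suc k) - w k)) \<Longrightarrow>
      k < n \<Longrightarrow> g (Suc k) \<noteq> 0 \<Longrightarrow> norm (g (Suc k)) = r"
proof -
  define t where "t k = sgn (g (Suc k) - g k)" for k
  define d where "d k = t k - t (Suc k)" for k
  have gain: "g (Suc k) \<bullet> d k > 0" if "g (Suc k) \<noteq> 0" for k
  proof -
    have "0 < - g (Suc k) \<bullet> (t (Suc k) - t k)"
      unfolding t_def
      using turn[of k] orig[of k] orig[of "Suc k"] that
      by (intro inner_turn_pos) (auto simp: wedge_def algebra_simps)
    then show ?thesis by (simp add: d_def inner_diff_right)
  qed
  have parts: "(\<Sum>k<n. (u (Suc k) - u k) \<bullet> t k) = (\<Sum>k<n. u (Suc k) \<bullet> d k)"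
    if "\<And>k. u (k + n) = u k" for u
  proof -
    have "(\<Sum>k<n. u (Suc k) \<bullet> t (Suc k)) = (\<Sum>k<n. u k \<bullet> t k)"
      using sum_periodic_shift[of "\<lambda>k. u k \<bullet> t k" n 1] that per[of "Suc k" for k]
      by (simp add: t_def per)
    then show ?thesis
      by (simp add: inner_diff_left inner_diff_right d_def sum_subtractf)
  qed
  have polar: "g k = norm (g k) *\<^sub>R sgn (g k)" for k
    by (cases "g k = 0") (simp_all add: sgn_div_norm)
  have push: "g (Suc k) \<bullet> d k \<le> w (Suc k) \<bullet> d k"
    and push_strict: "g (Suc k) \<noteq> 0 \<Longrightarrow> norm (g (Suc k)) < r \<Longrightarrow> g (Suc k) \<bullet> d k < w (Suc k) \<bullet> d k" for k
  proof -
    have *: "w (Suc k) \<bullet> d k - g (Suc k) \<bullet> d k = (r - norm (g (Suc k))) * (sgn (g (Suc k)) \<bullet> d k)"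
      unfolding w_def by (subst (2) polar) (simp add: algebra_simps)
    have **: "g (Suc k) \<noteq> 0 \<Longrightarrow> sgn (g (Suc k)) \<bullet> d k > 0"
      using gain[of k] by (simp add: sgn_div_norm)
    show "g (Suc k) \<bullet> d k \<le> w (Suc k) \<bullet> d k"
    proof (cases "g (Suc k) = 0")
      case True
      then show ?thesis by (simp add: w_def)
    next
      case False
      then have "0 \<le> (r - norm (g (Suc k))) * (sgn (g (Suc k)) \<bullet> d k)"
        using ** r[of "Suc k"] by (intro mult_nonneg_nonneg) auto
      then show ?thesis using * by linarith
    qed
    show "g (Suc k) \<bullet> d k < w (Suc k) \<bullet> d k" if "g (Suc k) \<noteq> 0" "norm (g (Suc k)) < r"
    proof -
      have "0 < (r - norm (g (Suc k))) * (sgn (g (Suc k)) \<bullet> d k)"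
        using ** that by (intro mult_pos_pos) auto
      then show ?thesis using * by linarith
    qed
  qed
  have L: "(\<Sum>k<n. norm (g (Suc k) - g k)) = (\<Sum>k<n. g (Suc k) \<bullet> d k)"
  proof -
    have "norm x = x \<bullet> sgn x" for x :: complex
      by (cases "x = 0") (simp_all add: sgn_div_norm power2_norm_eq_inner[symmetric] power2_eq_square)
    then show ?thesis using parts[of g, OF per] by (simp add: t_def)
  qed
  have R: "(\<Sum>k<n. w (Suc k) \<bullet> d k) \<le> (\<Sum>k<n. norm (w (Suc k) - w k))"
  proof -
    have "x \<bullet> t k \<le> norm x" for x k
    proof -
      have "x \<bullet> t k \<le> norm x * norm (t k)" by (rule norm_cauchy_schwarz)
      also have "\<dots> \<le> norm x * 1"
        by (intro mult_left_mono) (auto simp: t_def norm_sgn)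
      finally show ?thesis by simp
    qed
    then have "(\<Sum>k<n. (w (Suc k) - w k) \<bullet> t k) \<le> (\<Sum>k<n. norm (w (Suc k) - w k))"
      by (intro sum_mono)
    moreover have "(\<Sum>k<n. (w (Suc k) - w k) \<bullet> t k) = (\<Sum>k<n. w (Suc k) \<bullet> d k)"
      by (rule parts) (simp add: w_def per)
    ultimately show ?thesis by simp
  qed
  show "(\<Sum>k<n. norm (g (Suc k) - g k)) \<le> (\<Sum>k<n. norm (w (Suc k) - w k))"
    unfolding L using R sum_mono[of "{..<n}", OF push] by (meson order_trans)
  show "norm (g (Suc k)) = r"
    if eq: "(\<Sum>k<n. norm (g (Suc k) - g k)) = (\<Sum>k<n. norm (w (Suc k) - w k))"
      and k: "k < n" "g (Suc k) \<noteq> 0"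
  proof (rule ccontr)
    assume "norm (g (Suc k)) \<noteq> r"
    then have "g (Suc k) \<bullet> d k < w (Suc k) \<bullet> d k"
      using push_strict r[of "Suc k"] k by force
    then have "(\<Sum>k<n. g (Suc k) \<bullet> d k) < (\<Sum>k<n. w (Suc k) \<bullet> d k)"
      using k push by (intro sum_strict_mono_ex1) auto
    then show False using R L eq by linarith
  qed
qed

section \<open>Jensen's inequality for the sine\<close>

lemma sin_below_tangent:
  assumes "0 \<le> x" "x \<le> pi" "0 \<le> c" "c \<le> pi" "x \<noteq> c"
  shows "sin x < sin c + cos c * (x - c)"
proof (cases "c < x")
  case True
  obtain z where z: "c < z" "z < x" "sin x - sin c = (x - c) * cos z"
    using MVT2[OF True, of sin cos] by (auto intro: DERIV_sin)
  have "cos z < cos c" using z assms by (intro cos_monotone_0_pi) auto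
  then have "(x - c) * cos z < (x - c) * cos c" using True by simp
  then show ?thesis using z(3) by (simp add: mult.commute)
next
  case False
  then have lt: "x < c" using assms by simp
  obtain z where z: "x < z" "z < c" "sin c - sin x = (c - x) * cos z"
    using MVT2[OF lt, of sin cos] by (auto intro: DERIV_sin)
  have "cos c < cos z" using z assms by (intro cos_monotone_0_pi) auto
  then have "(c - x) * cos c < (c - x) * cos z" using lt by simp
  then show ?thesis using z(3) by (simp add: algebra_simps)
qed

text \<open>
  All the terms are compared with the tangent of the sine at the mean angle \<open>c\<close>. A sum of angles below
  \<open>N * c = pi / 2\<close> does no harm because that tangent is not decreasing.
\<close>
lemma sum_sin_le:
  fixes x :: "nat \<Rightarrow> real"
  assumes x: "\<And>k. k < N \<Longrightarrow> 0 \<le> x k \<and> x k \<le> pi / 2" and sum: "(\<Sum>k<N. x k) \<le> pi / 2" and "0 < N"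
  defines "c \<equiv> pi / (2 * real N)"
  shows "(\<Sum>k<N. sin (x k)) \<le> real N * sin c"
    and "(\<Sum>k<N. sin (x k)) = real N * sin c \<Longrightarrow> k < N \<Longrightarrow> x k = c"
proof -
  have N1: "real N \<ge> 1" using \<open>0 < N\<close> by linarith
  have "pi / (2 * real N) \<le> pi / 2" using N1 by (intro divide_left_mono) auto
  then have c: "0 \<le> c" "c \<le> pi / 2" using N1 by (auto simp: c_def)
  then have cpi: "c \<le> pi" using pi_gt_zero by linarith
  have xpi: "x k \<le> pi" if "k < N" for k using x[OF that] pi_gt_zero by linarith
  have le: "sin (x k) \<le> sin c + cos c * (x k - c)" if "k < N" for k
    using sin_below_tangent[of "x k" c] x[OF that] xpi[OF that] c(1) cpi by (cases "x k = c") auto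
  have T: "(\<Sum>k<N. sin c + cos c * (x k - c)) \<le> real N * sin c"
  proof -
    have "(\<Sum>k<N. sin c + cos c * (x k - c)) = real N * sin c + cos c * ((\<Sum>k<N. x k) - real N * c)"
      by (simp add: sum.distrib sum_distrib_left sum_subtractf right_diff_distrib)
    moreover have "real N * c = pi / 2" using \<open>0 < N\<close> by (simp add: c_def)
    moreover have "cos c \<ge> 0" using c by (intro cos_ge_zero) auto
    ultimately show ?thesis using sum by (simp add: mult_nonneg_nonpos)
  qed
  show "(\<Sum>k<N. sin (x k)) \<le> real N * sin c"
    using T sum_mono[of "{..<N}" "\<lambda>k. sin (x k)", OF le] by fastforce
  show "x k = c" if eq: "(\<Sum>k<N. sin (x k)) = real N * sin c" and k: "k < N"
  proof (rule ccontr)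
    assume "x k \<noteq> c"
    then have "sin (x k) < sin c + cos c * (x k - c)"
      using x[OF k] xpi[OF k] c(1) cpi by (intro sin_below_tangent) auto
    then have "(\<Sum>k<N. sin (x k)) < (\<Sum>k<N. sin c + cos c * (x k - c))"
      using k le by (intro sum_strict_mono_ex1) auto
    then show False using T eq by linarith
  qed
qed

section \<open>Adding up the angles under which the edges are seen\<close>

lemma wedge_divide: "a \<noteq> 0 \<Longrightarrow> wedge a b = (norm a)\<^sup>2 * Im (b / a)"
  by (simp add: wedge_def Im_divide cmod_power2 add_nonneg_eq_0_iff complex_eq_iff mult.commute)

text \<open>
  Each step turns left by less than \<open>pi\<close>, and all the points stay in the closed half-plane to the left
  of \<open>g 0\<close>; so the principal arguments add up without a jump by \<open>2 * pi\<close>.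
\<close>
lemma Arg_telescope:
  fixes g :: "nat \<Rightarrow> complex"
  assumes g0: "g 0 \<noteq> 0"
    and step: "\<And>k. k < m \<Longrightarrow> wedge (g k) (g (Suc k)) > 0"
    and half: "\<And>k. k \<le> m \<Longrightarrow> wedge (g 0) (g k) \<ge> 0"
  shows "j \<le> m \<Longrightarrow> Arg (g j / g 0) = (\<Sum>k<j. Arg (g (Suc k) / g k))"
proof (induction j)
  case 0
  then show ?case using g0 by simp
next
  case (Suc j)
  then have st: "wedge (g j) (g (Suc j)) > 0" using step by auto
  then have nz: "g j \<noteq> 0" "g (Suc j) \<noteq> 0" by (auto simp: wedge_def)
  have "Im (g (Suc j) / g j) > 0" using st wedge_divide[OF nz(1)] nz(1)
    by (simp add: zero_less_mult_iff)
  then have b: "0 < Arg (g (Suc j) / g j)" "Arg (g (Suc j) / g j) < pi"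
    using Arg_lt_pi by blast+
  have Im0: "Im (g i / g 0) \<ge> 0" if "i \<le> m" for i
    using half[OF that] wedge_divide[OF g0] g0 by (simp add: zero_le_mult_iff)
  have a: "0 \<le> Arg (g j / g 0)" "0 \<le> Arg (g (Suc j) / g 0)"
    using Im0 Suc.prems by (auto simp: Arg_less_0)
  have eq: "g (Suc j) / g 0 = (g j / g 0) * (g (Suc j) / g j)" using nz by simp
  have "Arg (g (Suc j) / g 0) = Arg (g j / g 0) + Arg (g (Suc j) / g j)"
    using Arg_times'[of "g j / g 0" "g (Suc j) / g j"] nz g0 a b Arg_bounded[of "g j / g 0"]
    unfolding eq[symmetric] by (auto split: if_splits)
  then show ?case using Suc by simp
qed

lemma norm_sgn_diff:
  assumes "a \<noteq> 0" "b \<noteq> 0"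
  shows "norm (sgn b - sgn a) = 2 * \<bar>sin (Arg (b / a) / 2)\<bar>"
proof -
  have "sgn b - sgn a = sgn a * (cis (Arg (b / a)) - 1)"
    using assms by (simp add: cis_Arg sgn_divide algebra_simps sgn_zero_iff)
  then show ?thesis
    using assms dist_exp_i_1[of "Arg (b / a)"] by (simp add: norm_mult norm_sgn cis_conv_exp)
qed

section \<open>The perimeter of a convex polygon with the origin on its boundary\<close>

lemma mod_add_neq: "0 < d \<Longrightarrow> d < n \<Longrightarrow> (k + d) mod n \<noteq> k mod (n::nat)"
  by (metis add_diff_cancel_left' gr_implies_not0 le_add1 mod_eq_dvd_iff_nat nat_dvd_not_less)

text \<open>
  The condition \<open>conv\<close> says that the polygon is strictly convex and runs counterclockwise. The origin
  is on the closing edge, and as \<open>g 0 \<noteq> 0\<close>, it is a vertex only if \<open>g (n - 1) = 0\<close>. In that case the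
  convention \<open>Arg 0 = 0\<close> provides the angle zero that makes up the number of \<open>n - 1\<close> angles, and this
  angle excludes equality.
\<close>
lemma convex_polygon_about_origin_perimeter:
  fixes g :: "nat \<Rightarrow> complex"
  assumes n: "3 \<le> n"
    and per: "\<And>k. g (k + n) = g k"
    and inj: "inj_on g {..<n}"
    and conv: "\<And>j k. g j \<noteq> g k \<Longrightarrow> g j \<noteq> g (Suc k) \<Longrightarrow> wedge (g (Suc k) - g k) (g j - g k) > 0"
    and zero: "0 \<in> closed_segment (g (n - 1)) (g 0)" "g 0 \<noteq> 0"
    and r: "\<And>k. norm (g k) \<le> r"
  shows "(\<Sum>k<n. norm (g (Suc k) - g k)) \<le> 2 * (1 + real (n - 1) * sin (pi / (2 * real (n - 1)))) * r"
    and "(\<Sum>k<n. norm (g (Suc k) - g k)) = 2 * (1 + real (n - 1) * sin (pi / (2 * real (n - 1)))) * r \<Longrightarrow>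
      norm (g 0) = r \<and> (\<forall>k<n. g k = g 0 * cis (real k * pi / real (n - 1)))"
proof -
  define p where "p = n - 2"
  have p: "n = Suc (Suc p)" "0 < p" using n by (auto simp: p_def)
  define m where "m = Suc p"
  have nm: "n = Suc m" "n - 1 = m" "m > 1" using p by (auto simp: m_def)
  have rpos: "r > 0" using r[of 0] zero(2) by (smt (verit) zero_less_norm_iff)
  have mod: "g k = g (k mod n)" for k
  proof -
    have "g (i + n * j) = g i" for i j
    proof (induction j)
      case (Suc j)
      have "g (i + n * Suc j) = g (i + n * j + n)" by (simp add: algebra_simps)
      then show ?case using Suc per by simp
    qed simp
    from this[of "k mod n" "k div n"] show ?thesis by simp
  qed
  have g_eq: "g i = g j \<longleftrightarrow> i mod n = j mod n" for i j
    using inj_onD[OF inj, of "i mod n" "j mod n"] mod[of i] mod[of j] n by auto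
  have ne: "g (k + d) \<noteq> g k" if "0 < d" "d < n" for k d
    using mod_add_neq[OF that] by (simp add: g_eq)
  have W: "wedge (g (Suc k) - g k) (g j - g k) \<ge> 0" for k j
    using conv[of j k] by (cases "g j = g k \<or> g j = g (Suc k)") (auto simp: wedge_def)
  have turn: "wedge (g (Suc k) - g k) (g (Suc (Suc k)) - g (Suc k)) > 0" for k
    using conv[of "Suc (Suc k)" k] ne[of 1 "Suc k"] ne[of 2 k] n
    by (simp add: wedge_def algebra_simps numeral_2_eq_2)
  \<comment> \<open>Since the origin is between \<open>g m\<close> and \<open>g 0\<close>, these are opposite; \<open>q = 0\<close> is the case of a
    vertex at the origin.\<close>
  obtain q where q: "q \<ge> 0" "g m = - (q *\<^sub>R g 0)"
  proof -
    obtain u where u: "0 \<le> u" "u \<le> 1" "0 = (1 - u) *\<^sub>R g m + u *\<^sub>R g 0"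
      using zero(1) unfolding nm by (auto simp: in_segment)
    have u1: "u < 1" using u zero(2) by (cases "u = 1") auto
    have "(1 - u) *\<^sub>R g m = - (u *\<^sub>R g 0)" using u(3) by (simp add: eq_neg_iff_add_eq_0)
    then have "(1 / (1 - u)) *\<^sub>R ((1 - u) *\<^sub>R g m) = (1 / (1 - u)) *\<^sub>R (- (u *\<^sub>R g 0))" by simp
    then have "g m = - ((u / (1 - u)) *\<^sub>R g 0)" using u1 by simp
    then show ?thesis using that[of "u / (1 - u)"] u u1 by simp
  qed
  \<comment> \<open>The origin is a weighted mean of \<open>g m\<close> and \<open>g 0\<close>, with weights proportional to \<open>1\<close> and \<open>q\<close>, and
    the cross product with a fixed edge is affine; so the position of the origin relative to an edge
    follows from those of two vertices.\<close>
  have orig_eq: "(1 + q) * wedge (g k) (g (Suc k)) =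
      wedge (g (Suc k) - g k) (g m - g k) + q * wedge (g (Suc k) - g k) (g 0 - g k)" for k
    unfolding q(2) by (simp add: wedge_def algebra_simps)
  have q1: "1 + q > 0" using q by simp
  have orig: "wedge (g k) (g (Suc k)) \<ge> 0" for k
  proof -
    have "(1 + q) * wedge (g k) (g (Suc k)) \<ge> 0"
      unfolding orig_eq using W q(1) by simp
    then show ?thesis using q1 by (simp add: zero_le_mult_iff)
  qed
  \<comment> \<open>The closing edge passes through the origin in the direction of \<open>g 0\<close>, so it bounds the
    half-plane that contains the polygon.\<close>
  have half: "wedge (g 0) (g k) \<ge> 0" for k
  proof -
    have "g (Suc m) = g 0" using per[of 0] nm by simp
    then have "wedge (g (Suc m) - g m) (g k - g m) = (1 + q) * wedge (g 0) (g k)"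
      unfolding q(2) by (simp add: wedge_def algebra_simps)
    then show ?thesis using W[of m k] q1 by (simp add: zero_le_mult_iff)
  qed
  have strict1: "wedge (g k) (g (Suc k)) > 0" if "k < p" for k
  proof -
    have "wedge (g (Suc k) - g k) (g m - g k) > 0"
      using that p by (intro conv) (auto simp: g_eq m_def)
    then have "(1 + q) * wedge (g k) (g (Suc k)) > 0"
      unfolding orig_eq using W[of k 0] q(1) by (simp add: add_pos_nonneg)
    then show ?thesis using q1 by (simp add: zero_less_mult_iff)
  qed
  have strict2: "wedge (g p) (g (Suc p)) > 0" if "q > 0"
  proof -
    have "wedge (g (Suc p) - g p) (g 0 - g p) > 0"
      using p by (intro conv) (auto simp: g_eq)
    then have "(1 + q) * wedge (g p) (g (Suc p)) > 0"
      unfolding orig_eq using W[of p m] that by (simp add: add_nonneg_pos)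
    then show ?thesis using q1 by (simp add: zero_less_mult_iff)
  qed
  have nz: "g k \<noteq> 0" if "k < m" for k
  proof (cases "k < p")
    case True
    then show ?thesis using strict1[of k] by (auto simp: wedge_def)
  next
    case False
    then have k: "k = p" using that m_def by simp
    show ?thesis
    proof (cases "q = 0")
      case True
      then show ?thesis using q(2) ne[of 1 p] n by (simp add: k m_def)
    next
      case False
      then show ?thesis using strict2 q(1) by (auto simp: wedge_def k)
    qed
  qed
  \<comment> \<open>A chord of the circle of radius \<open>r\<close> seen under the angle \<open>\<alpha>\<close> has length \<open>2 * r * sin (\<alpha> / 2)\<close>, so
    half of the angle is the convenient parameter.\<close>
  define x where "x k = Arg (g (Suc k) / g k) / 2" for k
  have x_nonneg: "0 \<le> x k" if "k < m" for k
    using orig[of k] wedge_divide[OF nz[OF that]] nz[OF that]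
    by (simp add: x_def Arg_less_0 zero_le_mult_iff)
  have x: "0 \<le> x k \<and> x k \<le> pi / 2" if "k < m" for k
    using x_nonneg[OF that] Arg_bounded by (simp add: x_def)
  have last0: "x p = 0" if "q = 0"
    using that q(2) by (simp add: x_def m_def[symmetric] Arg_zero)
  have tele: "Arg (g j / g 0) = (\<Sum>k<j. 2 * x k)" if "j \<le> m" "q > 0 \<or> j \<le> p" for j
  proof (cases "q > 0")
    case True
    have "Arg (g j / g 0) = (\<Sum>k<j. Arg (g (Suc k) / g k))"
      by (rule Arg_telescope[where m = m]) (use zero(2) half that strict1 strict2[OF True] in
          \<open>auto simp: m_def less_Suc_eq\<close>)
    then show ?thesis by (simp add: x_def)
  next
    case False
    have "Arg (g j / g 0) = (\<Sum>k<j. Arg (g (Suc k) / g k))"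
      by (rule Arg_telescope[where m = p]) (use zero(2) half that strict1 False in auto)
    then show ?thesis by (simp add: x_def)
  qed
  have sum_x: "(\<Sum>k<m. x k) \<le> pi / 2"
  proof -
    have "(\<Sum>k<m. 2 * x k) \<le> pi"
    proof (cases "q > 0")
      case True
      then show ?thesis using tele[of m] Arg_bounded[of "g m / g 0"] by simp
    next
      case False
      then have "(\<Sum>k<m. 2 * x k) = (\<Sum>k<p. 2 * x k)" using last0 q(1) by (simp add: m_def)
      then show ?thesis using tele[of p] Arg_bounded[of "g p / g 0"] by (simp add: m_def)
    qed
    then show ?thesis by (simp add: sum_distrib_left[symmetric])
  qed
  define w where "w k = r *\<^sub>R sgn (g k)" for k
  have chord: "norm (w (Suc k) - w k) = 2 * r * sin (x k)" if "k < m" "g (Suc k) \<noteq> 0" for k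
  proof -
    have "sin (x k) \<ge> 0" using x[OF that(1)] by (intro sin_ge_zero) auto
    moreover have "norm (w (Suc k) - w k) = r * norm (sgn (g (Suc k)) - sgn (g k))"
      using rpos by (simp add: w_def scaleR_diff_right[symmetric])
    ultimately show ?thesis
      using norm_sgn_diff[OF nz[OF that(1)] that(2)] by (simp add: x_def)
  qed
  have wn: "w (Suc m) = w 0" using per[of 0] nm by (simp add: w_def)
  have w0: "norm (w 0) = r" using zero(2) rpos by (simp add: w_def norm_sgn)
  have pushed: "(\<Sum>k<n. norm (w (Suc k) - w k)) = 2 * r + 2 * r * (\<Sum>k<m. sin (x k))"
  proof (cases "q = 0")
    case True
    then have wm: "w m = 0" using q(2) by (simp add: w_def)
    have "(\<Sum>k<p. norm (w (Suc k) - w k)) = (\<Sum>k<p. 2 * r * sin (x k))"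
      using nz by (intro sum.cong chord) (auto simp: m_def)
    moreover have "norm (w p) = r" using nz[of p] rpos by (simp add: w_def norm_sgn m_def)
    ultimately show ?thesis
      using wm wn w0 last0[OF True]
      by (simp add: nm(1) m_def[symmetric] sum_distrib_left) (simp add: m_def)
  next
    case False
    then have "q > 0" using q(1) by simp
    then have "w m = - w 0" using q(2) by (simp add: w_def sgn_scaleR sgn_minus)
    then have "norm (w (Suc m) - w m) = norm (2 *\<^sub>R w 0)" using wn by (simp add: scaleR_2)
    moreover have "(\<Sum>k<m. norm (w (Suc k) - w k)) = (\<Sum>k<m. 2 * r * sin (x k))"
    proof (intro sum.cong chord)
      fix k assume "k \<in> {..<m}"
      then show "g (Suc k) \<noteq> 0"
        using nz[of "Suc k"] q(2) zero(2) \<open>q > 0\<close> by (cases "Suc k = m") auto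
    qed auto
    ultimately show ?thesis using w0 by (simp add: nm(1) sum_distrib_left)
  qed
  have m0: "0 < m" using nm by simp
  have lengthen: "(\<Sum>k<n. norm (g (Suc k) - g k)) \<le> (\<Sum>k<n. norm (w (Suc k) - w k))"
    unfolding w_def by (rule radial_push_lengthens(1)[OF per turn orig r])
  have jensen: "(\<Sum>k<m. sin (x k)) \<le> real m * sin (pi / (2 * real m))"
    by (rule sum_sin_le(1)[OF x sum_x m0])
  have bound: "2 * r + 2 * r * (\<Sum>k<m. sin (x k)) \<le> 2 * (1 + real m * sin (pi / (2 * real m))) * r"
    using mult_left_mono[OF jensen, of "2 * r"] rpos by (simp add: algebra_simps)
  show "(\<Sum>k<n. norm (g (Suc k) - g k)) \<le> 2 * (1 + real (n - 1) * sin (pi / (2 * real (n - 1)))) * r"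
    using lengthen pushed bound nm by simp
  assume "(\<Sum>k<n. norm (g (Suc k) - g k)) = 2 * (1 + real (n - 1) * sin (pi / (2 * real (n - 1)))) * r"
  then have eq1: "(\<Sum>k<n. norm (g (Suc k) - g k)) = (\<Sum>k<n. norm (w (Suc k) - w k))"
    and eq2: "2 * r + 2 * r * (\<Sum>k<m. sin (x k)) = 2 * (1 + real m * sin (pi / (2 * real m))) * r"
    using lengthen pushed bound nm by simp_all
  have "2 * r * (\<Sum>k<m. sin (x k)) = 2 * r * (real m * sin (pi / (2 * real m)))"
    using eq2 by (simp add: algebra_simps)
  then have "(\<Sum>k<m. sin (x k)) = real m * sin (pi / (2 * real m))"
    using rpos by simp
  then have xc: "x k = pi / (2 * real m)" if "k < m" for k
    using sum_sin_le(2)[OF x sum_x m0] that by simp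
  have qpos: "q > 0"
  proof (rule ccontr)
    assume "\<not> q > 0"
    then have "x p = 0" using q(1) last0 by simp
    then show False using xc[of p] m0 by (simp add: m_def)
  qed
  have nz': "g k \<noteq> 0" if "k < n" for k
    using nz[of k] that nm q(2) qpos zero(2) by (cases "k = m") auto
  have norm_g: "norm (g k) = r" if "k < n" for k
  proof -
    have S: "norm (g (Suc i)) = r" if "i < n" "g (Suc i) \<noteq> 0" for i
      using radial_push_lengthens(2)[where g = g and n = n and r = r and k = i,
          OF per turn orig r eq1[unfolded w_def] that] .
    show ?thesis
    proof (cases k)
      case 0
      have "g (Suc m) = g 0" using per[of 0] nm by simp
      then show ?thesis using S[of m] 0 nz'[of 0] nm by simp
    next
      case (Suc i)
      then show ?thesis using S[of i] nz'[OF that] that by simp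
    qed
  qed
  have polar: "g k = g 0 * cis (real k * pi / real m)" if "k < n" for k
  proof -
    have "Arg (g k / g 0) = (\<Sum>i<k. 2 * x i)" using tele[of k] that qpos nm by simp
    also have "\<dots> = (\<Sum>i<k. pi / real m)" using xc that nm by (intro sum.cong) auto
    finally have "Arg (g k / g 0) = real k * pi / real m" by simp
    moreover have "norm (g k / g 0) = 1" using norm_g[OF that] norm_g[of 0] rpos n by (simp add: norm_divide)
    ultimately have "g k / g 0 = cis (real k * pi / real m)"
      using rcis_cmod_Arg[of "g k / g 0"] by (simp add: rcis_def)
    then show ?thesis using zero(2) by (simp add: field_simps)
  qed
  show "norm (g 0) = r \<and> (\<forall>k<n. g k = g 0 * cis (real k * pi / real (n - 1)))"
    unfolding nm(2) using norm_g[of 0] m0 nm(1) polar by blast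
qed

section \<open>Closed chains with periodic vertex numbering\<close>

text \<open>
  Indexing past the end of the list lets a closed chain be read from any of its vertices on.
\<close>
definition cyc :: "'a list \<Rightarrow> nat \<Rightarrow> 'a" where
  "cyc vs k = vs ! (k mod length vs)"

lemma cyc_add_length [simp]: "cyc vs (k + length vs) = cyc vs k"
  by (simp add: cyc_def)

lemma cyc_in_set: "vs \<noteq> [] \<Longrightarrow> cyc vs k \<in> set vs"
  by (simp add: cyc_def)

lemma cyc_eq_iff: "distinct vs \<Longrightarrow> vs \<noteq> [] \<Longrightarrow> cyc vs i = cyc vs j \<longleftrightarrow> i mod length vs = j mod length vs"
  by (simp add: cyc_def nth_eq_iff_index_eq)

lemma bij_betw_shift_mod:
  assumes "0 < (n::nat)"
  shows "bij_betw (\<lambda>k. (s + k) mod n) {..<n} {..<n}"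
proof -
  have "(\<lambda>k. (s + k) mod n) ` {..<n} = {..<n}"
  proof (intro equalityI subsetI)
    fix i assume i: "i \<in> {..<n}"
    have "(s + (i + n * s - s) mod n) mod n = (s + (i + n * s - s)) mod n"
      by (simp add: mod_simps)
    also have "s + (i + n * s - s) = i + n * s"
      using assms by (simp add: trans_le_add2)
    finally have "i = (s + (i + n * s - s) mod n) mod n" using i by simp
    moreover have "(i + n * s - s) mod n \<in> {..<n}" using assms by simp
    ultimately show "i \<in> (\<lambda>k. (s + k) mod n) ` {..<n}" by (rule image_eqI)
  qed (use assms in auto)
  then show ?thesis by (simp add: bij_betw_def eq_card_imp_inj_on)
qed

lemma cyc_shift_mod:
  "vs ! ((s + k) mod length vs) = cyc vs (s + k)"
  "vs ! (Suc ((s + k) mod length vs) mod length vs) = cyc vs (Suc (s + k))"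
  by (simp_all add: cyc_def mod_Suc_eq)

lemma closed_chain_cyc:
  assumes "vs \<noteq> []"
  shows "closed_chain vs = (\<Union>k<length vs. closed_segment (cyc vs (s + k)) (cyc vs (Suc (s + k))))"
proof -
  have "closed_chain vs = (\<Union>i\<in>(\<lambda>k. (s + k) mod length vs) ` {..<length vs}.
      closed_segment (vs ! i) (vs ! (Suc i mod length vs)))"
    using bij_betw_imp_surj_on[OF bij_betw_shift_mod[of "length vs" s]] assms
    by (simp add: closed_chain_def)
  then show ?thesis by (simp only: UN_simps cyc_shift_mod)
qed

lemma perimeter_cyc:
  assumes "vs \<noteq> []"
  shows "perimeter vs = (\<Sum>k<length vs. dist (cyc vs (s + k)) (cyc vs (Suc (s + k))))"
  using sum.reindex_bij_betw[OF bij_betw_shift_mod[of "length vs" s],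
      of "\<lambda>i. dist (vs ! i) (vs ! (Suc i mod length vs))"] assms
  by (simp add: perimeter_def cyc_shift_mod)

lemma edge_subset_closed_chain:
  assumes "vs \<noteq> []"
  shows "closed_segment (cyc vs k) (cyc vs (Suc k)) \<subseteq> closed_chain vs"
  using closed_chain_cyc[OF assms, of k] assms by force

lemma compact_closed_chain: "compact (closed_chain vs)"
  by (auto simp: closed_chain_def intro!: compact_UN)

lemma set_subset_closed_chain: "set vs \<subseteq> closed_chain vs"
proof
  fix v assume "v \<in> set vs"
  then obtain i where "i < length vs" "v = vs ! i" by (auto simp: in_set_conv_nth)
  then show "v \<in> closed_chain vs" unfolding closed_chain_def by (intro UN_I[of i]) auto
qed

section \<open>Edges and extreme points of convex polygons\<close>

text \<open>
  The separation theorem for points outside the relative interior applies unless \<open>K\<close> has empty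
  interior; but then \<open>K\<close> lies in a hyperplane, whose normal is a supporting functional everywhere.
\<close>
lemma supporting_functional:
  fixes K :: "'a::euclidean_space set"
  assumes "convex K" "closed K" "x \<in> frontier K"
  obtains h where "h \<noteq> 0" "\<And>y. y \<in> K \<Longrightarrow> h \<bullet> x \<le> h \<bullet> y"
proof (cases "interior K = {}")
  case True
  obtain h b where h: "h \<noteq> 0" and sub: "K \<subseteq> {y. h \<bullet> y = b}"
    by (rule empty_interior_subset_hyperplane[OF assms(1) True])
  have "x \<in> K" using assms frontier_subset_closed by blast
  then have "h \<bullet> x = h \<bullet> y" if "y \<in> K" for y using that sub by auto
  then show ?thesis using that[OF h] by simp
next
  case False
  then have "x \<notin> rel_interior K" "x \<in> closure K"
    using assms(3) by (auto simp: rel_interior_nonempty_interior frontier_def)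
  then obtain h where h: "h \<noteq> 0" "\<And>y. y \<in> closure K \<Longrightarrow> h \<bullet> x \<le> h \<bullet> y"
    using supporting_hyperplane_relative_frontier[OF assms(1)] by metis
  show ?thesis by (rule that[OF h(1)]) (use h(2) closure_subset in auto)
qed

lemma inner_constant_if_min_inside:
  fixes h :: "'a::euclidean_space"
  assumes m: "m \<in> open_segment a b" and le: "h \<bullet> m \<le> h \<bullet> a" "h \<bullet> m \<le> h \<bullet> b"
  shows "h \<bullet> a = h \<bullet> m" "h \<bullet> b = h \<bullet> m"
proof -
  obtain u where u: "0 < u" "u < 1" "m = (1 - u) *\<^sub>R a + u *\<^sub>R b"
    using m by (auto simp: in_segment)
  have "h \<bullet> m = (1 - u) * (h \<bullet> a) + u * (h \<bullet> b)"
    unfolding u(3) by (simp add: inner_add_right)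
  then have "(1 - u) * (h \<bullet> a - h \<bullet> m) + u * (h \<bullet> b - h \<bullet> m) = 0"
    by (simp add: algebra_simps)
  moreover have "(1 - u) * (h \<bullet> a - h \<bullet> m) \<ge> 0" "u * (h \<bullet> b - h \<bullet> m) \<ge> 0"
    using u le by (auto intro!: mult_nonneg_nonneg)
  ultimately have "(1 - u) * (h \<bullet> a - h \<bullet> m) = 0" "u * (h \<bullet> b - h \<bullet> m) = 0" by linarith+
  then show "h \<bullet> a = h \<bullet> m" "h \<bullet> b = h \<bullet> m" using u by auto
qed

text \<open>
  A functional supporting \<open>K\<close> at an inner point of the segment attains its minimum over the segment
  there, which makes it constant on the segment.
\<close>
lemma supporting_functional_segment:
  fixes K :: "'a::euclidean_space set"
  assumes K: "convex K" "closed K" and ab: "closed_segment a b \<subseteq> frontier K"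
    and m: "m \<in> open_segment a b"
  obtains h where "h \<noteq> 0" "h \<bullet> a = h \<bullet> m" "h \<bullet> b = h \<bullet> m" "\<And>y. y \<in> K \<Longrightarrow> h \<bullet> m \<le> h \<bullet> y"
proof -
  have K': "frontier K \<subseteq> K" using K(2) by (rule frontier_subset_closed)
  have "m \<in> frontier K" using ab m by (auto simp: open_segment_def)
  then obtain h where h: "h \<noteq> 0" "\<And>y. y \<in> K \<Longrightarrow> h \<bullet> m \<le> h \<bullet> y"
    using supporting_functional[OF K] by metis
  have "h \<bullet> m \<le> h \<bullet> a" "h \<bullet> m \<le> h \<bullet> b" using h(2) ab K' by auto
  from inner_constant_if_min_inside[OF m this] show ?thesis using that[OF h(1) _ _ h(2)] by simp
qed

lemma extreme_points_not_collinear: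
  fixes K :: "'a::euclidean_space set"
  assumes "a extreme_point_of K" "b extreme_point_of K" "c extreme_point_of K"
    and "a \<noteq> b" "a \<noteq> c" "b \<noteq> c"
  shows "\<not> collinear {a, b, c}"
  using assms unfolding collinear_between_cases between_mem_segment extreme_point_of_def
  by (auto simp: open_segment_def)

lemma collinear_level_line:
  fixes h :: "real^2"
  assumes "h \<noteq> 0" "\<And>x. x \<in> S \<Longrightarrow> h \<bullet> x = t"
  shows "collinear S"
proof -
  have "aff_dim S \<le> aff_dim {x. h \<bullet> x = t}" using assms(2) by (intro aff_dim_subset) auto
  also have "\<dots> = 1" using assms(1) by (simp add: aff_dim_hyperplane)
  finally show ?thesis by (simp add: collinear_aff_dim)
qed

lemma convex_polygonD:
  assumes "convex_polygon vs"
  shows "vs \<noteq> []" "distinct vs" "v \<in> set vs \<Longrightarrow> v extreme_point_of (convex hull set vs)"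
    "closed_chain vs = frontier (convex hull set vs)"
    "convex (convex hull set vs)" "closed (convex hull set vs)"
  using assms by (auto simp: convex_polygon_def compact_imp_closed finite_imp_compact_convex_hull)

text \<open>
  The midpoint of the segment is on some edge, and in the interior of it because it is not extreme. A
  functional supporting the polygon at the midpoint is constant on both the segment and the edge, so
  that their four ends lie on one line; but a line carries at most two extreme points. This is how
  the point set of a convex polygon determines its edges, and with them its perimeter.
\<close>
lemma frontier_segment_is_edge:
  assumes vs: "convex_polygon vs"
    and a: "a extreme_point_of (convex hull set vs)" and b: "b extreme_point_of (convex hull set vs)"
    and "a \<noteq> b" and ab: "closed_segment a b \<subseteq> closed_chain vs"
  obtains i where "i < length vs" "{a, b} = {cyc vs i, cyc vs (Suc i)}"
proof -
  note D = convex_polygonD[OF vs]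
  let ?K = "convex hull set vs"
  define m where "m = midpoint a b"
  have m: "m \<in> open_segment a b" using \<open>a \<noteq> b\<close> by (simp add: m_def)
  then have "m \<in> closed_chain vs" using ab by (auto simp: open_segment_def)
  then obtain i where i: "i < length vs" "m \<in> closed_segment (cyc vs i) (cyc vs (Suc i))"
    using closed_chain_cyc[OF D(1), of 0] by auto
  let ?v = "cyc vs i" and ?w = "cyc vs (Suc i)"
  have v: "?v extreme_point_of ?K" and w: "?w extreme_point_of ?K"
    using D(3) cyc_in_set[OF D(1)] by auto
  have nm: "\<not> m extreme_point_of ?K"
    using m a b by (auto simp: extreme_point_of_def)
  then have m': "m \<in> open_segment ?v ?w" using i(2) v w by (auto simp: open_segment_def)
  then have "?v \<noteq> ?w" by auto
  obtain h where h: "h \<noteq> 0" "h \<bullet> a = h \<bullet> m" "h \<bullet> b = h \<bullet> m" "\<And>y. y \<in> ?K \<Longrightarrow> h \<bullet> m \<le> h \<bullet> y"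
    using supporting_functional_segment[OF D(5,6) _ m] ab D(4) by metis
  have "h \<bullet> m \<le> h \<bullet> ?v" "h \<bullet> m \<le> h \<bullet> ?w"
    using h(4) v w by (auto simp: extreme_point_of_def)
  note vw = inner_constant_if_min_inside[OF m' this]
  have coll: "collinear {x, y, z}" if "{x, y, z} \<subseteq> {a, b, ?v, ?w}" for x y z
    using that h(2,3) vw by (intro collinear_level_line[OF h(1), of _ "h \<bullet> m"]) auto
  have "a \<in> {?v, ?w}"
    using extreme_points_not_collinear[OF a v w] coll[of a ?v ?w] \<open>?v \<noteq> ?w\<close> by auto
  moreover have "b \<in> {?v, ?w}"
    using extreme_points_not_collinear[OF b v w] coll[of b ?v ?w] \<open>?v \<noteq> ?w\<close> by auto
  ultimately show ?thesis using that[OF i(1)] \<open>a \<noteq> b\<close> by auto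
qed

section \<open>The relative Chebyshev radius\<close>

lemma dist_le_SUP_dist:
  fixes p :: "'a::metric_space"
  assumes "bounded P" "q \<in> P"
  shows "dist p q \<le> (SUP q\<in>P. dist p q)"
proof (rule cSUP_upper[OF assms(2)])
  obtain e where "\<forall>y\<in>P. dist p y \<le> e" using assms(1) bounded_any_center by blast
  then show "bdd_above (dist p ` P)" by (auto intro: bdd_aboveI2)
qed

text \<open>
  The distance to the farthest point of \<open>P\<close> is a Lipschitz function, so it attains its minimum on the
  compact set \<open>P\<close>.
\<close>
lemma rel_chebyshev_radius_attained:
  assumes "compact P" "P \<noteq> {}"
  obtains p where "p \<in> P" "\<And>q. q \<in> P \<Longrightarrow> dist p q \<le> rel_chebyshev_radius P"
proof -
  define F where "F p = (SUP q\<in>P. dist p q)" for p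
  have upper: "dist p q \<le> F p" if "q \<in> P" for p q
    unfolding F_def using assms(1) that by (intro dist_le_SUP_dist compact_imp_bounded)
  have lip: "F p \<le> F p' + dist p p'" for p p'
    unfolding F_def[of p] using assms(2)
  proof (rule cSUP_least)
    fix q assume "q \<in> P"
    show "dist p q \<le> F p' + dist p p'"
      using upper[OF \<open>q \<in> P\<close>, of p'] dist_triangle[of p q p'] by simp
  qed
  have "continuous_on P F"
    unfolding continuous_on_iff
  proof (intro ballI allI impI)
    fix x and e :: real assume "0 < e"
    have "dist (F x') (F x) \<le> dist x' x" for x'
      using lip[of x x'] lip[of x' x] by (auto simp: dist_real_def dist_commute)
    then show "\<exists>d>0. \<forall>x'\<in>P. dist x' x < d \<longrightarrow> dist (F x') (F x) < e"
      using \<open>0 < e\<close> by (intro exI[of _ e]) (auto intro: le_less_trans)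
  qed
  then obtain p where p: "p \<in> P" "\<And>x. x \<in> P \<Longrightarrow> F p \<le> F x"
    using continuous_attains_inf[OF assms] by metis
  have "F p \<le> rel_chebyshev_radius P"
    unfolding rel_chebyshev_radius_def F_def[symmetric] using assms(2) p(2) by (rule cINF_greatest)
  then show ?thesis using that[OF p(1)] upper order_trans by blast
qed

text \<open>
  By the triangle inequality every point has distance at least \<open>r\<close> from \<open>a\<close> or from \<open>b\<close>.
\<close>
lemma rel_chebyshev_radius_eq:
  assumes "c \<in> P" "P \<subseteq> cball c r" "a \<in> P" "b \<in> P" "dist a b = 2 * r"
  shows "rel_chebyshev_radius P = r"
proof (rule antisym)
  define F where "F p = (SUP q\<in>P. dist p q)" for p
  have "bounded P" using assms(2) bounded_cball bounded_subset by blast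
  then have upper: "dist p q \<le> F p" if "q \<in> P" for p q
    unfolding F_def using that by (intro dist_le_SUP_dist)
  have lower: "r \<le> F p" for p
    using upper[OF assms(3), of p] upper[OF assms(4), of p] dist_triangle3[of a b p] assms(5) by simp
  show "r \<le> rel_chebyshev_radius P"
    unfolding rel_chebyshev_radius_def F_def[symmetric] using assms(1) lower by (intro cINF_greatest) auto
  have "rel_chebyshev_radius P \<le> F c"
    unfolding rel_chebyshev_radius_def F_def[symmetric] using lower assms(1)
    by (intro cINF_lower bdd_belowI2[of _ r]) auto
  also have "F c \<le> r"
    unfolding F_def using assms(1,2) by (intro cSUP_least) auto
  finally show "rel_chebyshev_radius P \<le> r" .
qed

lemma rel_chebyshev_radius_isometric:
  assumes "isometric_sets S T"
  shows "rel_chebyshev_radius T = rel_chebyshev_radius S"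
proof -
  obtain f :: "real^2 \<Rightarrow> real^2" where f: "\<And>x y. dist (f x) (f y) = dist x y" "f ` S = T"
    using assms by (auto simp: isometric_sets_def)
  show ?thesis unfolding rel_chebyshev_radius_def f(2)[symmetric] by (simp add: image_image f(1))
qed

section \<open>Orientation of convex polygons\<close>

text \<open>
  Arguments, and the chords that they subtend, are at hand for complex numbers; the polygons of the
  theorem have their vertices in \<open>real^2\<close>.
\<close>
definition to_complex :: "real^2 \<Rightarrow> complex" where
  "to_complex x = Complex (x $ 1) (x $ 2)"

definition of_complex :: "complex \<Rightarrow> real^2" where
  "of_complex z = vector [Re z, Im z]"

lemma to_complex_of_complex [simp]: "to_complex (of_complex z) = z"
  by (simp add: to_complex_def of_complex_def)

lemma linear_to_complex: "linear to_complex"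
  by (rule linearI) (simp_all add: to_complex_def complex_eq_iff)

lemma norm_to_complex [simp]: "norm (to_complex x) = norm x"
  by (simp add: to_complex_def cmod_def norm_vec_def L2_set_def sum_2)

lemma norm_of_complex_diff: "norm (of_complex a - of_complex b) = norm (a - b)"
proof -
  have "of_complex a - of_complex b = of_complex (a - b)"
    by (simp add: of_complex_def vec_eq_iff forall_2)
  then show ?thesis by (metis norm_to_complex to_complex_of_complex)
qed

lemma wedge_cnj: "wedge (cnj a) (cnj b) = - wedge a b"
  by (simp add: wedge_def)

text \<open>
  In the plane, the functionals that vanish at \<open>e\<close> form a line; the cross product with \<open>e\<close> is one of
  them.
\<close>
lemma wedge_to_complex_orthogonal:
  fixes h e :: "real^2"
  assumes "h \<noteq> 0" "h \<bullet> e = 0"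
  obtains t where "\<And>y. wedge (to_complex e) (to_complex y) = t * (h \<bullet> y)"
proof
  fix y :: "real^2"
  have hh: "h \<bullet> h = h $ 1 * h $ 1 + h $ 2 * h $ 2"
    by (simp add: inner_vec_def sum_2)
  have hh0: "h \<bullet> h \<noteq> 0" using assms(1) by simp
  have he: "h $ 1 * e $ 1 + h $ 2 * e $ 2 = 0"
    using assms(2) by (simp add: inner_vec_def sum_2)
  have "(e $ 1 * h $ 2 - e $ 2 * h $ 1) * (h $ 1 * y $ 1 + h $ 2 * y $ 2) =
      (h \<bullet> h) * (e $ 1 * y $ 2 - e $ 2 * y $ 1)"
    unfolding hh using he by algebra
  then show "wedge (to_complex e) (to_complex y) = ((e $ 1 * h $ 2 - e $ 2 * h $ 1) / (h \<bullet> h)) * (h \<bullet> y)"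
    using hh0 by (simp add: wedge_def to_complex_def inner_vec_def[of h y] sum_2 field_simps)
qed

lemma wedge_eq_0_imp_collinear:
  assumes "a \<noteq> b" "wedge (to_complex (b - a)) (to_complex (c - a)) = 0"
  shows "collinear {a, b, c}"
proof -
  define h :: "real^2" where "h = vector [- ((b - a) $ 2), (b - a) $ 1]"
  have "h \<noteq> 0" using assms(1) by (auto simp: h_def vec_eq_iff forall_2)
  moreover have "h \<bullet> y = h \<bullet> a" if "y \<in> {a, b, c}" for y
    using that assms(2) by (auto simp: h_def inner_vec_def sum_2 wedge_def to_complex_def algebra_simps)
  ultimately show ?thesis by (rule collinear_level_line)
qed

text \<open>
  Each edge spans a supporting line, and no three vertices are collinear, so all the other vertices
  are strictly on one side of it. This side is the same for consecutive edges, because it can be read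
  off from the triangle of their three ends. If it is the right-hand side, complex conjugation makes
  it the left-hand side.
\<close>
lemma convex_polygon_counterclockwise:
  assumes vs: "convex_polygon vs" and n: "3 \<le> length vs"
  obtains L where "linear L" "\<And>x. norm (L x :: complex) = norm x"
    "\<And>j k. cyc vs j \<noteq> cyc vs k \<Longrightarrow> cyc vs j \<noteq> cyc vs (Suc k) \<Longrightarrow>
      wedge (L (cyc vs (Suc k) - cyc vs k)) (L (cyc vs j - cyc vs k)) > 0"
proof -
  note D = convex_polygonD[OF vs]
  let ?K = "convex hull set vs"
  define v where "v = cyc vs"
  define W where "W k j = wedge (to_complex (v (Suc k) - v k)) (to_complex (v j - v k))" for k j
  have ext: "v k extreme_point_of ?K" for k
    using D(3) cyc_in_set[OF D(1)] by (simp add: v_def)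
  then have vK: "v k \<in> ?K" for k by (simp add: extreme_point_of_def)
  have ne: "v (k + d) \<noteq> v k" if "0 < d" "d < length vs" for k d
    using mod_add_neq[OF that] cyc_eq_iff[OF D(2,1)] by (simp add: v_def)
  have ne1: "v (Suc k) \<noteq> v k" and ne2: "v (Suc (Suc k)) \<noteq> v k" for k
    using ne[of 1 k] ne[of 2 k] n by simp_all
  have W0: "W k j \<noteq> 0" if "v j \<noteq> v k" "v j \<noteq> v (Suc k)" for k j
    using wedge_eq_0_imp_collinear[of "v k" "v (Suc k)" "v j"] ne1[of k] that
      extreme_points_not_collinear[OF ext ext ext, of k "Suc k" j] by (auto simp: W_def)
  have "\<exists>s. (s = 1 \<or> s = - 1) \<and> (\<forall>j. v j \<noteq> v k \<longrightarrow> v j \<noteq> v (Suc k) \<longrightarrow> s * W k j > 0)" for k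
  proof -
    have "midpoint (v k) (v (Suc k)) \<in> open_segment (v k) (v (Suc k))" using ne1[of k] by simp
    moreover have "closed_segment (v k) (v (Suc k)) \<subseteq> frontier ?K"
      using edge_subset_closed_chain[OF D(1)] D(4) by (simp add: v_def)
    ultimately obtain h where h: "h \<noteq> 0" "h \<bullet> v k = h \<bullet> midpoint (v k) (v (Suc k))"
      "h \<bullet> v (Suc k) = h \<bullet> midpoint (v k) (v (Suc k))"
      "\<And>y. y \<in> ?K \<Longrightarrow> h \<bullet> midpoint (v k) (v (Suc k)) \<le> h \<bullet> y"
      using supporting_functional_segment[OF D(5,6)] by metis
    have "h \<bullet> (v (Suc k) - v k) = 0" using h(2,3) by (simp add: inner_diff_right)
    then obtain t where t: "\<And>y. wedge (to_complex (v (Suc k) - v k)) (to_complex y) = t * (h \<bullet> y)"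
      using wedge_to_complex_orthogonal[OF h(1)] by metis
    define s :: real where "s = (if t \<ge> 0 then 1 else - 1)"
    have "s * W k j \<ge> 0" for j
    proof -
      have "h \<bullet> (v j - v k) \<ge> 0" using h(2) h(4)[OF vK[of j]] by (simp add: inner_diff_right)
      then show ?thesis by (simp add: W_def t s_def mult_nonpos_nonneg)
    qed
    moreover have "s = 1 \<or> s = - 1" by (simp add: s_def)
    ultimately show ?thesis using W0[of _ k] by (metis less_eq_real_def mult_eq_0_iff neg_equal_0_iff_equal one_neq_zero)
  qed
  then obtain s where s: "\<And>k. s k = (1::real) \<or> s k = - 1"
    "\<And>k j. v j \<noteq> v k \<Longrightarrow> v j \<noteq> v (Suc k) \<Longrightarrow> s k * W k j > 0"
    by metis
  have s_eq: "s k = s 0" for k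
  proof (induction k)
    case (Suc k)
    \<comment> \<open>both are twice the signed area of the triangle of the vertices \<open>k\<close>, \<open>k + 1\<close>, \<open>k + 2\<close>\<close>
    have "W (Suc k) k = W k (Suc (Suc k))"
      by (simp add: W_def wedge_def to_complex_def algebra_simps)
    moreover have "s k * W k (Suc (Suc k)) > 0" using ne1 ne2 by (intro s(2))
    moreover have "s (Suc k) * W (Suc k) k > 0" using ne1[of k] ne2[of k] by (intro s(2)) (metis, metis)
    ultimately have "s (Suc k) = s k"
      using s(1)[of k] s(1)[of "Suc k"] by auto
    then show ?case using Suc by simp
  qed simp
  show ?thesis
  proof (cases "s 0 = 1")
    case True
    show ?thesis
      using that[OF linear_to_complex] s(2) s_eq True by (simp add: W_def v_def)
  next
    case False
    then have "s k = - 1" for k using s(1)[of 0] s_eq[of k] by simp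
    then have "W k j < 0" if "v j \<noteq> v k" "v j \<noteq> v (Suc k)" for k j
      using s(2)[OF that] by simp
    moreover have "linear (\<lambda>x. cnj (to_complex x))"
      by (rule linearI) (simp_all add: to_complex_def complex_eq_iff)
    ultimately show ?thesis
      using that[of "\<lambda>x. cnj (to_complex x)"] by (simp add: wedge_cnj W_def v_def)
  qed
qed

section \<open>The extremal polygon\<close>

lemma isometry_image_closed_segment:
  fixes f :: "real^2 \<Rightarrow> real^2"
  assumes "\<And>x y. dist (f x) (f y) = dist x y"
  shows "f ` closed_segment a b = closed_segment (f a) (f b)"
proof -
  define c where "c = f 0"
  define T where "T x = f x - c" for x
  have "orthogonal_transformation T"
    unfolding orthogonal_transformation_isometry using assms by (simp add: T_def c_def dist_norm)
  then have "linear T" by (simp add: orthogonal_transformation_def)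
  have f: "f x = c + T x" for x by (simp add: T_def)
  have "f ` closed_segment a b = (+) c ` T ` closed_segment a b"
    by (simp add: image_image f)
  then show ?thesis
    by (simp add: closed_segment_linear_image[OF \<open>linear T\<close>] closed_segment_translation f)
qed

text \<open>
  Listed like this, the edge from the last vertex back to the first one is the diameter.
\<close>
definition half_vertices :: "nat \<Rightarrow> real \<Rightarrow> (real^2) list" where
  "half_vertices n r = map (regular_vertex (2 * (n - 1)) r) [0..<n]"

lemma length_half_vertices [simp]: "length (half_vertices n r) = n"
  by (simp add: half_vertices_def)

lemma nth_half_vertices:
  "k < n \<Longrightarrow> half_vertices n r ! k = of_complex (r * cis (real k * pi / real (n - 1)))"
proof -
  assume "k < n"
  have "2 * pi * real k / real (2 * (n - 1)) = real k * pi / real (n - 1)"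
    unfolding of_nat_mult of_nat_numeral mult.assoc by (simp only: mult_divide_mult_cancel_left_if) (simp add: mult.commute)
  then show ?thesis
    using \<open>k < n\<close> by (simp add: half_vertices_def regular_vertex_def of_complex_def del: of_nat_mult of_nat_diff)
qed

lemma half_vertices_0: "2 \<le> n \<Longrightarrow> half_vertices n r ! 0 = vector [r, 0]"
  by (simp add: nth_half_vertices of_complex_def)

lemma half_vertices_last: "2 \<le> n \<Longrightarrow> half_vertices n r ! (n - 1) = vector [- r, 0]"
  by (simp add: nth_half_vertices of_complex_def)

lemma regular_vertex_nth_2:
  "regular_vertex m r k $ 2 = r * sin (2 * pi * real k / real m)"
  by (simp add: regular_vertex_def)

lemma norm_regular_vertex: "0 \<le> r \<Longrightarrow> norm (regular_vertex m r k) = r"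
  by (simp add: regular_vertex_def norm_vec_def L2_set_def sum_2 power_mult_distrib
      distrib_left[symmetric] real_sqrt_mult)

lemma diameter_point:
  fixes x :: "real^2"
  assumes "norm x \<le> r" "x $ 2 = 0"
  shows "x \<in> closed_segment (vector [r, 0]) (vector [- r, 0])"
proof (cases "r = 0")
  case True
  then show ?thesis using assms(1) by (auto simp: vec_eq_iff forall_2)
next
  case False
  then have r: "r > 0" using assms(1) norm_ge_zero[of x] by linarith
  have "\<bar>x $ 1\<bar> \<le> r" using assms(1) component_le_norm_cart[of x 1] by simp
  then show ?thesis
    unfolding in_segment using r assms(2)
    by (intro exI[of _ "(r - x $ 1) / (2 * r)"]) (auto simp: vec_eq_iff forall_2 field_simps)
qed

text \<open>
  The first \<open>n - 1\<close> edges of the regular polygon are in the upper half-plane. The other ones are in the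
  lower half-plane, so what they have in common with the upper one is on the horizontal axis and
  within the disk, that is, on the diameter.
\<close>
lemma U_eq_closed_chain:
  assumes n: "2 \<le> n" and r: "0 < r"
  shows "U n r = closed_chain (half_vertices n r)"
proof -
  define m where "m = n - 1"
  have m: "0 < m" "n = Suc m" using n by (auto simp: m_def)
  define R where "R = regular_vertex (2 * m) r"
  define E where "E i = closed_segment (R i) (R (Suc i))" for i
  have R0: "R 0 = vector [r, 0]" and Rm: "R m = vector [- r, 0]"
    using m by (simp_all add: R_def regular_vertex_def)
  have R_last: "R (2 * m) = R 0" using m by (simp add: R_def regular_vertex_def)
  have polygon: "regular_polygon (2 * m) r = (\<Union>i<2 * m. E i)"
  proof -
    have "map R [0..<2 * m] ! (Suc i mod (2 * m)) = R (Suc i)" if "i < 2 * m" for i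
      using that R_last m by (cases "Suc i = 2 * m") auto
    then show ?thesis
      unfolding regular_polygon_def closed_chain_def R_def[symmetric] E_def
      by (intro SUP_cong) auto
  qed
  have chain: "closed_chain (half_vertices n r) = (\<Union>i<m. E i) \<union> closed_segment (R m) (R 0)"
  proof -
    have "half_vertices n r = map R [0..<Suc m]" by (simp add: half_vertices_def R_def m)
    then have *: "half_vertices n r ! i = R i" if "i \<le> m" for i
      using that by (simp del: upt_Suc)
    have "closed_chain (half_vertices n r) =
        (\<Union>i<m. closed_segment (half_vertices n r ! i) (half_vertices n r ! (Suc i mod n))) \<union>
        closed_segment (half_vertices n r ! m) (half_vertices n r ! (Suc m mod n))"
      unfolding closed_chain_def length_half_vertices by (subst m(2), subst lessThan_Suc, subst UN_insert) (rule Un_commute)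
    also have "\<dots> = (\<Union>i<m. E i) \<union> closed_segment (R m) (R 0)"
      unfolding E_def using * m by (intro arg_cong2[of _ _ _ _ "(\<union>)"] SUP_cong) auto
    finally show ?thesis .
  qed
  have upper: "E i \<subseteq> {x. 0 \<le> x $ 2}" if "i < m" for i
  proof -
    have "R j $ 2 \<ge> 0" if "j \<le> m" for j
    proof -
      have "2 * pi * real j / real (2 * m) \<le> pi" using that m by (simp add: field_simps)
      then show ?thesis using r m unfolding R_def regular_vertex_nth_2
        by (intro mult_nonneg_nonneg sin_ge_zero) auto
    qed
    moreover have "convex {x :: real^2. 0 \<le> x $ 2}"
      using convex_halfspace_ge[of 0 "axis 2 1 :: real^2"] by (simp add: inner_axis')
    ultimately show ?thesis unfolding E_def using that by (intro closed_segment_subset) auto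
  qed
  have lower: "E i \<inter> {x. 0 \<le> x $ 2} \<subseteq> closed_segment (R m) (R 0)" if "m \<le> i" "i < 2 * m" for i
  proof -
    have "R j $ 2 \<le> 0" if "m \<le> j" "j \<le> 2 * m" for j
    proof -
      have "pi \<le> 2 * pi * real j / real (2 * m)" "2 * pi * real j / real (2 * m) \<le> 2 * pi"
        using that m by (simp_all add: field_simps)
      then have "sin (2 * pi * real j / real (2 * m)) \<le> 0"
        using sin_ge_zero[of "2 * pi * real j / real (2 * m) - pi"] by (simp add: sin_diff)
      then show ?thesis using r unfolding R_def regular_vertex_nth_2 by (simp add: mult_nonneg_nonpos)
    qed
    moreover have "convex {x :: real^2. x $ 2 \<le> 0}"
      using convex_halfspace_le[of "axis 2 1 :: real^2" 0] by (simp add: inner_axis')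
    ultimately have "E i \<subseteq> {x. x $ 2 \<le> 0}" unfolding E_def using that by (intro closed_segment_subset) auto
    moreover have "E i \<subseteq> cball 0 r"
      unfolding E_def using r by (intro closed_segment_subset) (auto simp: R_def norm_regular_vertex)
    ultimately have "x \<in> closed_segment (R 0) (R m)" if "x \<in> E i" "0 \<le> x $ 2" for x
      unfolding R0 Rm using that by (intro diameter_point) (auto intro: antisym)
    then show ?thesis unfolding closed_segment_commute[of "R m"] by blast
  qed
  have le1: "(\<Union>i<2 * m. E i) \<inter> {x. 0 \<le> x $ 2} \<subseteq> (\<Union>i<m. E i) \<union> closed_segment (R m) (R 0)"
  proof
    fix x assume "x \<in> (\<Union>i<2 * m. E i) \<inter> {x. 0 \<le> x $ 2}"
    then obtain i where "i < 2 * m" "x \<in> E i" "0 \<le> x $ 2" by auto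
    then show "x \<in> (\<Union>i<m. E i) \<union> closed_segment (R m) (R 0)"
      using lower[of i] by (cases "i < m") auto
  qed
  have le2: "(\<Union>i<m. E i) \<subseteq> (\<Union>i<2 * m. E i) \<inter> {x. 0 \<le> x $ 2}"
  proof
    fix x assume "x \<in> (\<Union>i<m. E i)"
    then obtain i where "i < m" "x \<in> E i" by auto
    then show "x \<in> (\<Union>i<2 * m. E i) \<inter> {x. 0 \<le> x $ 2}" using upper[of i] by auto
  qed
  have "U n r = closed_segment (R m) (R 0) \<union> ((\<Union>i<2 * m. E i) \<inter> {x. 0 \<le> x $ 2})"
    unfolding U_def Let_def m_def[symmetric] R_def[symmetric] polygon
    by (simp only: closed_segment_commute[of "R 0"])
  moreover have "S \<union> B = A \<union> S" if "B \<subseteq> A \<union> S" "A \<subseteq> B" for A B S :: "(real^2) set"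
    using that by blast
  ultimately show ?thesis unfolding chain using le1 le2 by simp
qed

lemma closed_chain_half_vertices_subset:
  assumes "2 \<le> n" "0 \<le> r"
  shows "closed_chain (half_vertices n r) \<subseteq> cball 0 r"
  unfolding closed_chain_def length_half_vertices
proof (intro UN_least closed_segment_subset)
  fix i assume "i \<in> {..<n}"
  have "half_vertices n r ! j \<in> cball 0 r" if "j < n" for j
    using that assms by (simp add: half_vertices_def norm_regular_vertex)
  then show "half_vertices n r ! i \<in> cball 0 r" "half_vertices n r ! (Suc i mod n) \<in> cball 0 r"
    using \<open>i \<in> {..<n}\<close> by auto
qed simp

lemma diameter_subset_U:
  assumes "2 \<le> n"
  shows "vector [r, 0] \<in> U n r" "vector [- r, 0] \<in> U n r" "0 \<in> U n r"
proof -
  have "regular_vertex (2 * (n - 1)) r 0 = vector [r, 0]"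
    by (simp add: regular_vertex_def)
  moreover have "regular_vertex (2 * (n - 1)) r (n - 1) = vector [- r, 0]"
    using half_vertices_last[OF assms, of r] assms by (simp add: half_vertices_def)
  ultimately have sub: "closed_segment (vector [r, 0]) (vector [- r, 0]) \<subseteq> U n r"
    by (simp add: U_def Let_def)
  then show "vector [r, 0] \<in> U n r" "vector [- r, 0] \<in> U n r" by auto
  have "(0 :: real^2) \<in> closed_segment (vector [r, 0]) (vector [- r, 0])"
    unfolding in_segment by (intro exI[of _ "1 / 2"]) (auto simp: vec_eq_iff forall_2)
  then show "0 \<in> U n r" using sub by blast
qed

lemma rel_chebyshev_radius_U:
  assumes "2 \<le> n" "0 < r"
  shows "rel_chebyshev_radius (U n r) = r"
proof (rule rel_chebyshev_radius_eq)
  show "dist (vector [r, 0] :: real^2) (vector [- r, 0]) = 2 * r"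
    using assms(2) by (simp add: dist_norm norm_vec_def L2_set_def sum_2 real_sqrt_mult)
  show "U n r \<subseteq> cball 0 r"
    using closed_chain_half_vertices_subset U_eq_closed_chain assms by simp
qed (use diameter_subset_U assms in auto)

lemma perimeter_half_vertices:
  assumes "2 \<le> n" "0 < r"
  shows "perimeter (half_vertices n r) = 2 * (1 + real (n - 1) * sin (pi / (2 * real (n - 1)))) * r"
proof -
  define m where "m = n - 1"
  have m: "0 < m" "n = Suc m" using assms(1) by (auto simp: m_def)
  have side: "dist (half_vertices n r ! i) (half_vertices n r ! Suc i) = 2 * r * sin (pi / (2 * real m))"
    if "i < m" for i
  proof -
    have "pi / (2 * real m) \<le> pi" using m by (simp add: field_simps)
    then have s: "sin (pi / (2 * real m)) \<ge> 0" by (intro sin_ge_zero) auto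
    define a where "a = real i * pi / real m"
    have a: "real (Suc i) * pi / real m = a + pi / real m" by (simp add: a_def add_divide_distrib distrib_right)
    have "dist (half_vertices n r ! i) (half_vertices n r ! Suc i)
        = norm (r * cis (a + pi / real m) - r * cis a)"
      using that m a
      by (simp add: nth_half_vertices dist_norm norm_of_complex_diff a_def norm_minus_commute)
    also have "r * cis (a + pi / real m) - r * cis a = r * (cis a * (cis (pi / real m) - 1))"
      by (simp add: cis_mult[symmetric] algebra_simps)
    also have "norm \<dots> = r * (2 * \<bar>sin (pi / real m / 2)\<bar>)"
      using assms(2) dist_exp_i_1[of "pi / real m"] by (simp add: norm_mult cis_conv_exp)
    finally show ?thesis using s by (simp add: mult.commute)
  qed
  have "dist (half_vertices n r ! m) (half_vertices n r ! 0) = 2 * r"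
    using half_vertices_0[OF assms(1), of r] half_vertices_last[OF assms(1), of r] assms(2)
    by (simp add: m_def dist_norm norm_vec_def L2_set_def sum_2 real_sqrt_mult)
  moreover have "perimeter (half_vertices n r) =
      (\<Sum>i<m. dist (half_vertices n r ! i) (half_vertices n r ! Suc i)) +
      dist (half_vertices n r ! m) (half_vertices n r ! 0)"
    unfolding perimeter_def length_half_vertices by (simp add: m)
  ultimately show ?thesis
    unfolding m_def[symmetric] using side by (simp add: algebra_simps)
qed

lemma distinct_half_vertices:
  assumes "2 \<le> n" "0 < r"
  shows "distinct (half_vertices n r)"
  unfolding distinct_conv_nth length_half_vertices
proof (intro allI impI)
  fix i j assume ij: "i < n" "j < n" "i \<noteq> j"
  show "half_vertices n r ! i \<noteq> half_vertices n r ! j"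
  proof
    assume "half_vertices n r ! i = half_vertices n r ! j"
    then have "cis (real i * pi / real (n - 1)) = cis (real j * pi / real (n - 1))"
      using ij assms(2) by (metis nth_half_vertices to_complex_of_complex mult_left_cancel of_real_eq_0_iff less_irrefl)
    then have "cos (real i * pi / real (n - 1)) = cos (real j * pi / real (n - 1))"
      by (metis cis.sel(1))
    moreover have "real k * pi / real (n - 1) \<in> {0..pi}" if "k < n" for k
    proof -
      have "real k * pi \<le> real (n - 1) * pi" using that by (intro mult_right_mono) auto
      moreover have "0 < real (n - 1)" using assms(1) by simp
      ultimately have "real k * pi / real (n - 1) \<le> pi" by (simp only: pos_divide_le_eq mult.commute)
      then show ?thesis by simp
    qed
    ultimately have "real i * pi / real (n - 1) = real j * pi / real (n - 1)"
      using ij by (metis atLeastAtMost_iff cos_inj_pi)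
    then show False using ij assms(1) by simp
  qed
qed

section \<open>The perimeter bound and its equality case\<close>

text \<open>
  Multiplication by \<open>cnj (sgn z)\<close> is the rotation that takes \<open>z\<close> to the positive real axis. Composed
  with it, the map \<open>x \<mapsto> L (x - p)\<close> takes the given vertices to those of the extremal polygon.
\<close>
lemma isometric_to_U:
  assumes n: "2 \<le> length vs" and L: "linear L" "\<And>x. norm (L x :: complex) = norm x"
    and z: "z \<noteq> 0"
    and v: "\<And>k. k < length vs \<Longrightarrow> L (cyc vs (s + k) - p) = z * cis (real k * pi / real (length vs - 1))"
  shows "isometric_sets (closed_chain vs) (U (length vs) (norm z))"
proof -
  define n where "n = length vs"
  have n2: "2 \<le> n" "vs \<noteq> []" using n by (auto simp: n_def)
  define F where "F x = of_complex (L (x - p) * cnj (sgn z))" for x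
  have iso: "dist (F x) (F y) = dist x y" for x y
  proof -
    have "L (x - p) * cnj (sgn z) - L (y - p) * cnj (sgn z) = L (x - y) * cnj (sgn z)"
      by (simp add: linear_diff[OF L(1)] algebra_simps)
    then show ?thesis
      using z by (simp add: F_def dist_norm norm_of_complex_diff norm_mult norm_sgn L(2))
  qed
  have zz: "z * cnj (sgn z) = norm z"
    using z by (simp add: sgn_eq complex_norm_square[symmetric] power2_eq_square)
  have vertex: "F (cyc vs (s + k)) = cyc (half_vertices n (norm z)) k" for k
  proof -
    have less: "F (cyc vs (s + k)) = cyc (half_vertices n (norm z)) k" if "k < n" for k
    proof -
      have "F (cyc vs (s + k)) = of_complex ((z * cnj (sgn z)) * cis (real k * pi / real (n - 1)))"
        using v[of k] that by (simp add: F_def n_def mult_ac)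
      then show ?thesis using that by (simp add: zz cyc_def nth_half_vertices)
    qed
    have "cyc vs (s + k) = cyc vs (s + k mod n)"
      by (simp add: cyc_def n_def mod_simps)
    moreover have "k mod n < n" using n2 by simp
    ultimately show ?thesis using less[of "k mod n"] by (simp add: cyc_def)
  qed
  have "F ` closed_chain vs = (\<Union>k<n. F ` closed_segment (cyc vs (s + k)) (cyc vs (Suc (s + k))))"
    using closed_chain_cyc[OF n2(2), of s] by (simp add: image_UN n_def)
  also have "\<dots> = (\<Union>k<n. closed_segment (cyc (half_vertices n (norm z)) k) (cyc (half_vertices n (norm z)) (Suc k)))"
    using vertex vertex[of "Suc k" for k] by (simp add: isometry_image_closed_segment[OF iso])
  also have "\<dots> = closed_chain (half_vertices n (norm z))"
  proof -
    have "half_vertices n (norm z) \<noteq> []" using n2 length_half_vertices by (metis list.size(3) not_numeral_le_zero)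
    then show ?thesis using closed_chain_cyc[of "half_vertices n (norm z)" 0] by simp
  qed
  also have "\<dots> = U n (norm z)" using U_eq_closed_chain n2 z by simp
  finally show ?thesis unfolding isometric_sets_def n_def using iso by blast
qed

lemma perimeter_le_rel_chebyshev_radius:
  assumes vs: "convex_polygon vs" and n: "length vs = n" "3 \<le> n"
  defines "P \<equiv> closed_chain vs"
  shows "perimeter vs \<le> 2 * (1 + real (n - 1) * sin (pi / (2 * real (n - 1)))) * rel_chebyshev_radius P"
    and "perimeter vs = 2 * (1 + real (n - 1) * sin (pi / (2 * real (n - 1)))) * rel_chebyshev_radius P
      \<Longrightarrow> \<exists>r>0. isometric_sets P (U n r)"
proof -
  note D = convex_polygonD[OF vs]
  define v where "v = cyc vs"
  have v_eq: "v i = v j \<longleftrightarrow> i mod n = j mod n" for i j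
    using cyc_eq_iff[OF D(2,1)] n by (simp add: v_def)
  have per: "v (k + n) = v k" for k by (simp add: v_def n(1)[symmetric])
  have vP: "v k \<in> P" for k
    using set_subset_closed_chain cyc_in_set[OF D(1)] by (auto simp: v_def P_def)
  obtain p where p: "p \<in> P" and far: "\<And>q. q \<in> P \<Longrightarrow> dist p q \<le> rel_chebyshev_radius P"
    using rel_chebyshev_radius_attained[of P] vP compact_closed_chain by (metis P_def empty_iff)
  obtain s where s: "p \<in> closed_segment (v (s + (n - 1))) (v s)" "p \<noteq> v s"
  proof -
    obtain k where k: "p \<in> closed_segment (v k) (v (Suc k))"
      using p closed_chain_cyc[OF D(1), of 0] by (auto simp: P_def v_def)
    have shift: "v (Suc i + (n - 1)) = v i" for i using per[of i] n by simp
    \<comment> \<open>If \<open>p\<close> is the second end of the edge that contains it, the next edge is taken instead.\<close>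
    show ?thesis
    proof (cases "p = v (Suc k)")
      case False
      then show ?thesis using that[of "Suc k"] k shift[of k] by simp
    next
      case True
      have "v (Suc k) \<noteq> v (Suc (Suc k))"
        using mod_add_neq[of 1 n "Suc k"] n unfolding v_eq by simp
      then show ?thesis using that[of "Suc (Suc k)"] True shift[of "Suc k"] by simp
    qed
  qed
  obtain L where L: "linear L" "\<And>x. norm (L x :: complex) = norm x"
    and turn: "\<And>j k. v j \<noteq> v k \<Longrightarrow> v j \<noteq> v (Suc k) \<Longrightarrow> wedge (L (v (Suc k) - v k)) (L (v j - v k)) > 0"
    using convex_polygon_counterclockwise[OF vs] n unfolding v_def by metis
  define g where "g k = L (v (s + k) - p)" for k
  have g_diff: "g j - g k = L (v (s + j) - v (s + k))" for j k
    by (simp add: g_def linear_diff[OF L(1)])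
  have L0: "L x = 0 \<longleftrightarrow> x = 0" for x using L(2)[of x] by (metis norm_eq_zero)
  have g_eq: "g j = g k \<longleftrightarrow> v (s + j) = v (s + k)" for j k
    using g_diff[of j k] L0[of "v (s + j) - v (s + k)"] by auto
  have g_per: "g (k + n) = g k" for k
    using per[of "s + k"] by (simp add: g_def add.assoc)
  have g_inj: "inj_on g {..<n}"
  proof (rule inj_onI)
    fix i j assume ij: "i \<in> {..<n}" "j \<in> {..<n}" "g i = g j"
    then have "(s + i) mod n = (s + j) mod n" by (simp add: g_eq v_eq)
    then show "i = j"
      using ij bij_betw_imp_inj_on[OF bij_betw_shift_mod[of n s]] n by (auto dest: inj_onD)
  qed
  have g_turn: "wedge (g (Suc k) - g k) (g j - g k) > 0" if "g j \<noteq> g k" "g j \<noteq> g (Suc k)" for j k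
    using that turn[of "s + j" "s + k"] by (simp add: g_diff g_eq)
  have g_zero: "0 \<in> closed_segment (g (n - 1)) (g 0)"
  proof -
    have "0 \<in> closed_segment (v (s + (n - 1)) - p) (v s - p)"
      using s(1) closed_segment_translation_eq[of "- p" p "v (s + (n - 1))" "v s"] by simp
    then show ?thesis
      unfolding g_def using closed_segment_linear_image[OF L(1)] linear_0[OF L(1)] by (metis add.right_neutral imageI)
  qed
  have g0: "g 0 \<noteq> 0" using s(2) L0[of "v s - p"] by (simp add: g_def)
  have g_le: "norm (g k) \<le> rel_chebyshev_radius P" for k
    using far[OF vP[of "s + k"]] by (simp add: g_def L(2) dist_norm norm_minus_commute)
  have per_eq: "perimeter vs = (\<Sum>k<n. norm (g (Suc k) - g k))"
    using perimeter_cyc[OF D(1), of s] n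
    by (simp add: g_diff L(2) dist_norm v_def norm_minus_commute)
  note core = convex_polygon_about_origin_perimeter[where g = g,
      OF n(2) g_per g_inj g_turn g_zero g0 g_le]
  show "perimeter vs \<le> 2 * (1 + real (n - 1) * sin (pi / (2 * real (n - 1)))) * rel_chebyshev_radius P"
    unfolding per_eq by (rule core(1))
  assume "perimeter vs = 2 * (1 + real (n - 1) * sin (pi / (2 * real (n - 1)))) * rel_chebyshev_radius P"
  then have "\<forall>k<n. g k = g 0 * cis (real k * pi / real (n - 1))"
    using core(2) unfolding per_eq by blast
  then have "isometric_sets (closed_chain vs) (U (length vs) (norm (g 0)))"
    using n by (intro isometric_to_U[OF _ L g0, of vs s p]) (auto simp: g_def v_def)
  then show "\<exists>r>0. isometric_sets P (U n r)" using g0 n(1)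
    by (intro exI[of _ "norm (g 0)"]) (simp add: P_def)
qed

section \<open>Polygons isometric to the extremal one\<close>

text \<open>
  For \<open>n = 2\<close> this fails: the two edges of a segment, there and back, have the same ends.
\<close>
lemma consecutive_pair_eq_imp_eq:
  fixes k l n :: nat
  assumes "3 \<le> n" "k < n" "l < n" "{k, Suc k mod n} = {l, Suc l mod n}"
  shows "k = l"
  using assms by (auto simp: doubleton_eq_iff mod_Suc split: if_splits)

text \<open>
  Let \<open>a k\<close> be the points of \<open>P\<close> that the isometry takes to the vertices of \<open>U n r\<close>. They are extreme,
  since they are on the boundary of a disk that contains \<open>P\<close>, and the segments between consecutive
  ones are contained in \<open>P\<close>; so these segments are edges of \<open>P\<close>. They are \<open>n\<close> different ones, hence
  all the edges.
\<close>
lemma perimeter_if_isometric_to_U: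
  assumes vs: "convex_polygon vs" and n: "length vs = n" "3 \<le> n" and r: "0 < r"
    and iso: "isometric_sets (closed_chain vs) (U n r)"
  shows "perimeter vs = 2 * (1 + real (n - 1) * sin (pi / (2 * real (n - 1)))) * r"
proof -
  note D = convex_polygonD[OF vs]
  let ?K = "convex hull set vs"
  define P where "P = closed_chain vs"
  define us where "us = half_vertices n r"
  have us: "us \<noteq> []" "length us = n" "distinct us"
    using n r distinct_half_vertices[of n r] length_half_vertices[of n r]
    by (auto simp: us_def simp del: length_half_vertices)
  obtain f :: "real^2 \<Rightarrow> real^2" where f: "\<And>x y. dist (f x) (f y) = dist x y" "f ` P = U n r"
    using iso by (auto simp: isometric_sets_def P_def)
  have U: "U n r = closed_chain us" using n r U_eq_closed_chain by (simp add: us_def)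
  have inj: "f x = f y \<longleftrightarrow> x = y" for x y using f(1)[of x y] by (metis dist_eq_0_iff)
  have "\<exists>x\<in>P. f x = cyc us k" for k
  proof -
    have "cyc us k \<in> f ` P"
      using set_subset_closed_chain[of us] cyc_in_set[OF us(1)] by (auto simp: f(2) U)
    then show ?thesis by auto
  qed
  then obtain a where a: "\<And>k. a k \<in> P" "\<And>k. f (a k) = cyc us k" by metis
  have "0 \<in> f ` P" using diameter_subset_U(3) n by (simp add: f(2))
  then obtain c where c: "f c = 0" by auto
  have ball: "?K \<subseteq> cball c r"
  proof (rule hull_minimal)
    have "dist c x \<le> r" if "x \<in> P" for x
    proof -
      have "f x \<in> closed_chain us" using that f(2) U by auto
      then have "f x \<in> cball 0 r"
        using closed_chain_half_vertices_subset[of n r] n r by (auto simp: us_def)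
      then show ?thesis using f(1)[of c x] c by simp
    qed
    then show "set vs \<subseteq> cball c r" using set_subset_closed_chain[of vs] by (auto simp: P_def)
  qed simp
  have PK: "P \<subseteq> ?K" using D(4,6) frontier_subset_closed by (simp add: P_def)
  have ext: "a k extreme_point_of ?K" for k
  proof -
    have "norm (cyc us k) = r"
      using us(2) n r by (simp add: cyc_def us_def half_vertices_def norm_regular_vertex)
    then have "dist c (a k) = r" using f(1)[of c "a k"] c a(2) by simp
    moreover have "dist c x \<le> r" if "x \<in> ?K" for x using ball that by auto
    ultimately show ?thesis
      unfolding extreme_point_of_def using PK a(1)[of k] dist_decreases_open_segment[of "a k" _ _ c] by force
  qed
  have a_eq: "a i = a j \<longleftrightarrow> i mod n = j mod n" for i j
    using inj[of "a i" "a j"] cyc_eq_iff[OF us(3,1)] us(2) by (simp add: a(2))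
  have seg: "closed_segment (a k) (a (Suc k)) \<subseteq> P" for k
  proof
    fix x assume "x \<in> closed_segment (a k) (a (Suc k))"
    then have "f x \<in> closed_segment (cyc us k) (cyc us (Suc k))"
      using isometry_image_closed_segment[of f "a k" "a (Suc k)"] f(1) a(2) by auto
    then have "f x \<in> f ` P" using edge_subset_closed_chain[OF us(1)] by (auto simp: f(2) U)
    then show "x \<in> P" using inj by auto
  qed
  have "\<exists>i<n. {a k, a (Suc k)} = {cyc vs i, cyc vs (Suc i)}" for k
  proof -
    have "a k \<noteq> a (Suc k)" using mod_add_neq[of 1 n k] n unfolding a_eq by simp
    then show ?thesis
      using frontier_segment_is_edge[OF vs ext ext _ seg[unfolded P_def]] n by metis
  qed
  then obtain e where e: "\<And>k. e k < n" "\<And>k. {a k, a (Suc k)} = {cyc vs (e k), cyc vs (Suc (e k))}"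
    by metis
  have "inj_on e {..<n}"
  proof (rule inj_onI)
    fix k l assume kl: "k \<in> {..<n}" "l \<in> {..<n}" "e k = e l"
    then have "{a k, a (Suc k)} = {a l, a (Suc l)}" using e(2)[of k] e(2)[of l] by simp
    then have "{k, Suc k mod n} = {l, Suc l mod n}"
      using kl by (auto simp: doubleton_eq_iff a_eq)
    then show "k = l" using consecutive_pair_eq_imp_eq n kl by auto
  qed
  then have e_bij: "bij_betw e {..<n} {..<n}"
    using e(1) by (intro bij_betw_imageI endo_inj_surj) auto
  have "dist (cyc us k) (cyc us (Suc k)) = dist (cyc vs (e k)) (cyc vs (Suc (e k)))" for k
  proof -
    have "dist (a k) (a (Suc k)) = dist (cyc vs (e k)) (cyc vs (Suc (e k)))"
      using e(2)[of k] by (auto simp: doubleton_eq_iff dist_commute)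
    then show ?thesis using f(1)[of "a k" "a (Suc k)"] by (simp add: a(2))
  qed
  then have "perimeter us = (\<Sum>k<n. dist (cyc vs (e k)) (cyc vs (Suc (e k))))"
    using perimeter_cyc[OF us(1), of 0] us(2) by simp
  also have "\<dots> = perimeter vs"
    using sum.reindex_bij_betw[OF e_bij, of "\<lambda>i. dist (cyc vs i) (cyc vs (Suc i))"]
      perimeter_cyc[OF D(1), of 0] n by simp
  finally show ?thesis using perimeter_half_vertices[of n r] n r by (simp add: us_def)
qed

lemma rel_chebyshev_radius_segment:
  fixes a b :: "real^2"
  shows "rel_chebyshev_radius (closed_segment a b) = dist a b / 2"
proof (rule rel_chebyshev_radius_eq)
  show "closed_segment a b \<subseteq> cball (midpoint a b) (dist a b / 2)"
    by (intro closed_segment_subset) (auto simp: dist_midpoint)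
qed auto

lemma segment_isometric_to_U:
  fixes a b :: "real^2"
  assumes "a \<noteq> b"
  shows "isometric_sets (closed_segment a b) (U 2 (dist a b / 2))"
proof -
  define z where "z = to_complex (a - midpoint a b)"
  have "a - midpoint a b = (1 / 2) *\<^sub>R (a - b)"
    by (simp add: midpoint_def vec_eq_iff field_simps)
  then have z: "z = to_complex ((1 / 2) *\<^sub>R (a - b))" by (simp add: z_def)
  have nz: "norm z = dist a b / 2" unfolding z by (simp add: dist_norm)
  have "b - midpoint a b = - ((1 / 2) *\<^sub>R (a - b))"
    by (simp add: midpoint_def vec_eq_iff field_simps)
  then have "to_complex (b - midpoint a b) = - z"
    unfolding z by (simp only: linear_neg[OF linear_to_complex])
  moreover have "to_complex (a - midpoint a b) = z" by (simp add: z_def)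
  moreover have "z \<noteq> 0" using nz assms by auto
  ultimately have "isometric_sets (closed_chain [a, b]) (U (length [a, b]) (norm z))"
    by (intro isometric_to_U[OF _ linear_to_complex, where s = 0 and p = "midpoint a b"])
      (auto simp: less_Suc_eq cyc_def)
  then show ?thesis using nz by (simp add: closed_chain_2 numeral_2_eq_2)
qed

theorem theorem4:
  fixes n :: nat and vs :: "(real^2) list" and P :: "(real^2) set"
  assumes "n \<ge> 2"
    and "convex_polygon vs" and "length vs = n" and "P = closed_chain vs"
  shows "perimeter vs \<le> 2 * (1 + real (n - 1) * sin (pi / (2 * real (n - 1)))) * rel_chebyshev_radius P
    \<and> (perimeter vs = 2 * (1 + real (n - 1) * sin (pi / (2 * real (n - 1)))) * rel_chebyshev_radius P
        \<longleftrightarrow> (\<exists>r>0. isometric_sets P (U n r)))"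
proof (cases "n = 2")
  case True
  then obtain a b where ab: "vs = [a, b]"
    using assms(3) by (auto simp: numeral_2_eq_2 length_Suc_conv)
  then have "a \<noteq> b" using assms(2) by (simp add: convex_polygon_2)
  moreover have "perimeter vs = 2 * (1 + real (n - 1) * sin (pi / (2 * real (n - 1)))) * rel_chebyshev_radius P"
    by (simp add: ab True perimeter_2 assms(4) closed_chain_2 rel_chebyshev_radius_segment)
  moreover have "P = closed_segment a b" by (simp add: ab assms(4) closed_chain_2)
  ultimately show ?thesis
    using segment_isometric_to_U[of a b] True by (auto intro!: exI[of _ "dist a b / 2"])
next
  case False
  then have n: "3 \<le> n" using assms(1) by simp
  have "perimeter vs = 2 * (1 + real (n - 1) * sin (pi / (2 * real (n - 1)))) * rel_chebyshev_radius P"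
    if "0 < r" "isometric_sets P (U n r)" for r
  proof -
    have "rel_chebyshev_radius P = r"
      using rel_chebyshev_radius_isometric[OF that(2)] rel_chebyshev_radius_U[OF assms(1) that(1)] by simp
    then show ?thesis
      using perimeter_if_isometric_to_U[OF assms(2,3) n that(1)] that(2) by (simp add: assms(4))
  qed
  then show ?thesis
    using perimeter_le_rel_chebyshev_radius[OF assms(2,3) n] assms(4) by blast
qed

end
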